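(* Let $d\geq5$ and let $2\leq r\leq d-3$ be integers. The head $Q_{\mathcal{A}(d,r)}=G_{\mathcal{A}(d,r)}/\bigoplus_{\ell=1}^\infty\mathrm{Alt}(X^\ell)$ of the telescope $\mathcal{A}(d,r)$ is a $2$-generated infinite simple group.
   Context: The telescope $\mathcal{A}(d,r)$: let $X=\{x_1,\dots,x_d\}$ be a set with $d$ elements, and let $X^\ell$ be the set of words of length $\ell$ over $X$. For $\ell\geq1$ put $\Omega_\ell=\mathrm{Alt}(X^\ell)$ and for $\ell\leq k$ let $\iota_{\ell,k}\colon\Omega_\ell\to\Omega_k$ be the embedding $\iota_{\ell,k}(\sigma)(vw)=\sigma(v)w$ for $v\in X^\ell$, $w\in X^{k-\ell}$. Let $B=\mathrm{Alt}(\{x_1,\dots,x_r\}\times X)\cong\mathrm{Alt}(rd)$, viewed as the subgroup of $\Omega_2$ fixing all words $x_ix_j$ with $i>r$. For $\ell\geq2$ define $\phi_\ell\colon B\to\Omega_\ell$ by $\phi_\ell(\sigma)(vxy)=v\,\sigma(xy)$ if $v=x_d^{\ell-2}$ and $\phi_\ell(\sigma)(vxy)=vxy$ otherwise, for $v\in X^{\ell-2}$, $x,y\in X$. The group of the telescope: let $P=\prod_{\ell=1}^\infty\Omega_\ell$ with projections $\pi_\ell$. Let $\Delta_1\colon\Omega_1\to P$, $\Delta_1(\omega)=(\omega,\iota_{1,2}(\omega),\iota_{1,3}(\omega),\dots)$. For $g\in B$ let $\tilde g^{[1]}\in P$ be given by $\pi_1(\tilde g^{[1]})=1$ and $\pi_i(\tilde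 g^{[1]})=\prod_{k=2}^{i}\iota_{k,i}(\phi_k(g))$ for $i>1$ (the factors commute), and let $C^{[1]}=\{\tilde g^{[1]}\mid g\in B\}$. Then $G_{\mathcal{A}(d,r)}=\langle\Delta_1(\Omega_1),C^{[1]}\rangle\leq P$; it contains $\bigoplus_{\ell=1}^\infty\mathrm{Alt}(X^\ell)$ as a normal subgroup. *)

theory Defs
  imports "HOL-Algebra.Algebra"
begin

text \<open>
  \<^const>\<open>alt_group\<close> of HOL-Algebra lives on \<open>{1..n}\<close> only; \<open>Alt A\<close> is the same group on an arbitrary
  finite set \<open>A\<close>. Its elements are the identity outside \<open>A\<close>, so \<open>Alt A\<close> is literally a subgroup
  of \<open>Alt B\<close> whenever \<open>A\<close> is a subset of \<open>B\<close>.
\<close>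
definition Alt :: "'a set \<Rightarrow> ('a \<Rightarrow> 'a) monoid"
  where "Alt A = \<lparr>carrier = {p. p permutes A \<and> evenperm p}, monoid.mult = (\<circ>), one = id\<rparr>"

lemma Alt_eq_alt_group: "Alt {1..n} = alt_group n"
  by (simp add: Alt_def alt_group_def sym_group_def)

lemma group_Alt:
  assumes "finite A"
  shows "group (Alt A)"
proof (rule groupI)
  have perm: "permutation p" if "p permutes A" for p :: "'a \<Rightarrow> 'a"
    using that assms by (auto simp: permutation_permutes)
  show "\<one>\<^bsub>Alt A\<^esub> \<in> carrier (Alt A)"
    by (simp add: Alt_def permutes_id evenperm_id)
  fix p assume p: "p \<in> carrier (Alt A)"
  then have p': "p permutes A" "evenperm p" by (simp_all add: Alt_def)
  show "\<one>\<^bsub>Alt A\<^esub> \<otimes>\<^bsub>Alt A\<^esub> p = p" by (simp add: Alt_def)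
  show "\<exists>q\<in>carrier (Alt A). q \<otimes>\<^bsub>Alt A\<^esub> p = \<one>\<^bsub>Alt A\<^esub>"
  proof (rule bexI)
    show "inv_into UNIV p \<otimes>\<^bsub>Alt A\<^esub> p = \<one>\<^bsub>Alt A\<^esub>"
      using permutes_inv_o(2)[OF p'(1)] by (simp add: Alt_def)
    show "inv_into UNIV p \<in> carrier (Alt A)"
      using permutes_inv[OF p'(1)] evenperm_inv[OF perm[OF p'(1)]] p'(2) by (simp add: Alt_def)
  qed
  fix q assume q: "q \<in> carrier (Alt A)"
  then have q': "q permutes A" "evenperm q" by (simp_all add: Alt_def)
  show "p \<otimes>\<^bsub>Alt A\<^esub> q \<in> carrier (Alt A)"
    using permutes_compose[OF q'(1) p'(1)] evenperm_comp[OF perm[OF p'(1)] perm[OF q'(1)]] p'(2) q'(2)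
    by (simp add: Alt_def)
  fix s assume "s \<in> carrier (Alt A)"
  show "p \<otimes>\<^bsub>Alt A\<^esub> q \<otimes>\<^bsub>Alt A\<^esub> s = p \<otimes>\<^bsub>Alt A\<^esub> (q \<otimes>\<^bsub>Alt A\<^esub> s)"
    by (simp add: Alt_def comp_assoc)
qed

text \<open>
  The locale \<^locale>\<open>simple_group\<close> of HOL-Algebra demands \<^term>\<open>order G > 1\<close>; as the order of an
  infinite group is \<open>0\<close> there, it excludes infinite groups. Hence the usual definition is
  given here; for finite groups the two agree.
\<close>
definition is_simple_group :: "('a, 'b) monoid_scheme \<Rightarrow> bool"
  where "is_simple_group G \<longleftrightarrow>
    group G \<and> carrier G \<noteq> {\<one>\<^bsub>G\<^esub>} \<and> (\<forall>H. H \<lhd> G \<longrightarrow> H = carrier G \<or> H = {\<one>\<^bsub>G\<^esub>})"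

lemma is_simple_group_finite_iff:
  assumes "finite (carrier G)"
  shows "is_simple_group G \<longleftrightarrow> simple_group G"
proof
  assume s: "is_simple_group G"
  then interpret group G by (simp add: is_simple_group_def)
  have "{\<one>\<^bsub>G\<^esub>} \<subset> carrier G" using s by (auto simp: is_simple_group_def)
  from psubset_card_mono[OF assms this] have ord: "order G > 1"
    by (simp add: order_def)
  show "simple_group G"
  proof
    show "order G > 1" by (rule ord)
    show "H = carrier G \<or> H = {\<one>\<^bsub>G\<^esub>}" if "H \<lhd> G" for H
      using s that by (simp add: is_simple_group_def)
  qed
next
  assume "simple_group G"
  then interpret simple_group G .
  show "is_simple_group G"
    unfolding is_simple_group_def
    using simple_not_triv no_real_normal_subgroup is_group by blast
qed

definition is_two_generated :: "('a, 'b) monoid_scheme \<Rightarrow> bool"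
  where "is_two_generated G \<longleftrightarrow>
    (\<exists>a\<in>carrier G. \<exists>b\<in>carrier G. generate G {a, b} = carrier G)"


text \<open>The letter \<open>x\<^sub>i\<close> is represented by the number \<open>i\<close>, so \<open>X = {1..d}\<close>.\<close>

definition telescope_words :: "nat \<Rightarrow> nat \<Rightarrow> nat list set"
  where "telescope_words d l = {w. set w \<subseteq> {1..d} \<and> length w = l}"

definition telescope_Omega :: "nat \<Rightarrow> nat \<Rightarrow> (nat list \<Rightarrow> nat list) monoid"
  where "telescope_Omega d l = Alt (telescope_words d l)"

definition telescope_iota ::
    "nat \<Rightarrow> nat \<Rightarrow> nat \<Rightarrow> (nat list \<Rightarrow> nat list) \<Rightarrow> nat list \<Rightarrow> nat list"
  where "telescope_iota d l k \<sigma> =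
    (\<lambda>w. if w \<in> telescope_words d k then \<sigma> (take l w) @ drop l w else w)"

definition telescope_B :: "nat \<Rightarrow> nat \<Rightarrow> (nat list \<Rightarrow> nat list) monoid"
  where "telescope_B d r = Alt {[i, j] | i j. i \<in> {1..r} \<and> j \<in> {1..d}}"

definition telescope_phi ::
    "nat \<Rightarrow> nat \<Rightarrow> (nat list \<Rightarrow> nat list) \<Rightarrow> nat list \<Rightarrow> nat list"
  where "telescope_phi d l \<sigma> =
    (\<lambda>w. if w \<in> telescope_words d l \<and> take (l - 2) w = replicate (l - 2) d
         then take (l - 2) w @ \<sigma> (drop (l - 2) w) else w)"

definition telescope_P :: "nat \<Rightarrow> (nat \<Rightarrow> nat list \<Rightarrow> nat list) monoid"
  where "telescope_P d = product_group {1..} (telescope_Omega d)"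

definition telescope_Delta1 :: "nat \<Rightarrow> (nat list \<Rightarrow> nat list) \<Rightarrow> nat \<Rightarrow> nat list \<Rightarrow> nat list"
  where "telescope_Delta1 d \<omega> = (\<lambda>i\<in>{1..}. telescope_iota d 1 i \<omega>)"

definition telescope_tilde :: "nat \<Rightarrow> (nat list \<Rightarrow> nat list) \<Rightarrow> nat \<Rightarrow> nat list \<Rightarrow> nat list"
  where "telescope_tilde d g =
    (\<lambda>i\<in>{1..}. if i = 1 then id
       else foldr (\<circ>) (map (\<lambda>k. telescope_iota d k i (telescope_phi d k g)) [2..<i + 1]) id)"

definition telescope_group :: "nat \<Rightarrow> nat \<Rightarrow> (nat \<Rightarrow> nat list \<Rightarrow> nat list) monoid"
  where "telescope_group d r = (telescope_P d)
    \<lparr>carrier := generate (telescope_P d)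
       (telescope_Delta1 d ` carrier (telescope_Omega d 1) \<union>
        telescope_tilde d ` carrier (telescope_B d r))\<rparr>"

definition telescope_head :: "nat \<Rightarrow> nat \<Rightarrow> (nat \<Rightarrow> nat list \<Rightarrow> nat list) set monoid"
  where "telescope_head d r =
    telescope_group d r Mod carrier (sum_group {1..} (telescope_Omega d))"

end

theory Submission
  imports Defs
begin

text \<open>
  A family of permutations, one of each \<open>X\<^sup>l\<close>, is the same as one length-preserving map on all
  words, and dividing by the direct sum means looking at long words only. In this picture the
  generators of the telescope have a simple form: an element of \<open>Alt(X)\<close> changes the first letter,
  and an element \<open>g\<close> of \<open>B\<close> skips all leading letters \<open>d\<close> and then applies \<open>g\<close> to the next two
  letters (\<open>tail_act\<close>). The group that they generate is called \<open>tower\<close>, and the proof studies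
  it up to equality on long words (\<open>fin_eq\<close>).

  \<^bold>\<open>Prefix actions.\<close> The action of \<open>g\<close> below \<open>d\<^sup>k\<close> is a permutation of the prefixes of length
  \<open>k + 2\<close> followed by the action of \<open>g\<close> below \<open>d\<^bsup>k+1\<^esup>\<close> (\<open>branch_single_split\<close>). The two parts are
  separated by a commutator with a three-cycle on \<open>d\<^sup>kd\<close>, \<open>d\<^sup>k(r+1)\<close>, \<open>d\<^sup>k(r+2)\<close>: it moves the
  second part away and centralises the first (\<open>shift_commutator\<close>). This is where \<open>r \<le> d - 3\<close> enters.
  By induction the tower contains the alternating group of every \<open>X\<^sup>k\<close>, acting on prefixes
  (\<open>tower_prefix_act\<close>), hence also the direct sum of these groups.

  \<^bold>\<open>Simplicity.\<close> Away from finitely many points an element of the tower replaces prefixes by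
  prefixes. An element that is nontrivial on long words therefore maps some \<open>uz\<close> to \<open>vz\<close> for all
  \<open>z\<close>, with \<open>u \<noteq> v\<close> of the same length (\<open>tower_moves_rigidly\<close>). A double commutator then
  shows that its normal closure contains the commutators of all even permutations below \<open>u\<close>, hence
  a three-cycle, hence all prefix actions, and by \<open>shift_commutator\<close> also the tail actions
  (\<open>normal_subgroup_of_tower\<close>).

  \<^bold>\<open>Two generators.\<close> For large \<open>l\<close> put all double transpositions \<open>g\<close> of pairs below different
  words of length \<open>l\<close>; this is an involution \<open>\<tau>\<close>, and it commutes with a three-cycle \<open>\<alpha>\<close> of words
  of length \<open>l + 1\<close> below an unused word. As the orders of \<open>\<alpha>\<close> and \<open>\<tau>\<close> are coprime, \<open>\<alpha>\<tau>\<close> generates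
  both, and together with a second generator of \<open>Alt(X\<^bsup>l+1\<^esup>)\<close> it yields everything
  (\<open>tower_two_generators\<close>).

  The head is infinite because the three-cycles \<open>probe i\<close> act differently on long words.
\<close>

section \<open>Groups of bijections and the generation of alternating groups\<close>

text \<open>Subgroups of the group of all bijections are represented by their element sets. This is convenient
  because different subgroups, and sets of permutations of a subset, are compared all the time.\<close>

definition perm_group :: "('a \<Rightarrow> 'a) set \<Rightarrow> bool"
  where "perm_group M \<longleftrightarrow> id \<in> M \<and> (\<forall>f\<in>M. bij f \<and> inv' f \<in> M \<and> (\<forall>g\<in>M. f \<circ> g \<in> M))"

definition conj_by :: "('a \<Rightarrow> 'a) \<Rightarrow> ('a \<Rightarrow> 'a) \<Rightarrow> 'a \<Rightarrow> 'a"
  where "conj_by f g = f \<circ> g \<circ> inv' f"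

definition commutator :: "('a \<Rightarrow> 'a) \<Rightarrow> ('a \<Rightarrow> 'a) \<Rightarrow> 'a \<Rightarrow> 'a"
  where "commutator f g = f \<circ> g \<circ> inv' f \<circ> inv' g"

definition cycle3 :: "'a \<Rightarrow> 'a \<Rightarrow> 'a \<Rightarrow> 'a \<Rightarrow> 'a"
  where "cycle3 a b c = Transposition.transpose a b \<circ> Transposition.transpose b c"

lemma perm_groupD:
  assumes "perm_group M"
  shows "id \<in> M" and "f \<in> M \<Longrightarrow> bij f" and "f \<in> M \<Longrightarrow> inv' f \<in> M"
    and "f \<in> M \<Longrightarrow> g \<in> M \<Longrightarrow> f \<circ> g \<in> M"
    and "f \<in> M \<Longrightarrow> g \<in> M \<Longrightarrow> conj_by f g \<in> M"
    and "f \<in> M \<Longrightarrow> g \<in> M \<Longrightarrow> commutator f g \<in> M"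
  using assms by (auto simp: perm_group_def conj_by_def commutator_def)

lemma inv_bij_simps [simp]:
  assumes "bij f"
  shows "inv' f (f x) = x" and "f (inv' f x) = x"
  using assms by (auto simp: bij_is_inj bij_is_surj surj_f_inv_f)

lemma conj_by_comp: "bij f \<Longrightarrow> conj_by f (g \<circ> h) = conj_by f g \<circ> conj_by f h"
  by (auto simp: conj_by_def fun_eq_iff)

lemma bij_conj_by: "bij f \<Longrightarrow> bij g \<Longrightarrow> bij (conj_by f g)"
  by (simp add: conj_by_def bij_comp bij_imp_bij_inv)

text \<open>A commutator is determined by the two orders in which its factors can be multiplied; this is
  how commutators are computed below, cancelling a common factor of the two products.\<close>

lemma commutator_eqI:
  assumes "bij f" "bij g" "bij h" "f \<circ> g = s \<circ> t \<circ> h" "g \<circ> f = t \<circ> s \<circ> h" "bij s" "bij t"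
  shows "commutator f g = commutator s t"
proof -
  have "commutator f g = (f \<circ> g) \<circ> inv' (g \<circ> f)"
    using assms(1,2) by (simp add: commutator_def o_inv_distrib o_assoc)
  also have "\<dots> = s \<circ> t \<circ> h \<circ> inv' (t \<circ> s \<circ> h)" by (simp add: assms(4,5))
  also have "inv' (t \<circ> s \<circ> h) = inv' h \<circ> (inv' s \<circ> inv' t)"
    using assms by (simp add: o_inv_distrib bij_comp)
  finally show ?thesis using assms(3) by (simp add: commutator_def fun_eq_iff)
qed

lemma disjoint_support_commute:
  assumes "bij f" "bij g" and disj: "\<And>x. f x = x \<or> g x = x"
  shows "f \<circ> g = g \<circ> f"
proof
  fix x
  show "(f \<circ> g) x = (g \<circ> f) x"
  proof (cases "f x = x")
    case True
    then have "f (g x) = g x"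
      by (metis disj assms(2) bij_pointE)
    then show ?thesis by (simp add: True)
  next
    case False
    then have "g (f x) = f x" "g x = x"
      by (metis disj assms(1) bij_pointE)+
    then show ?thesis by simp
  qed
qed

subsection \<open>Three-cycles\<close>

lemma bij_cycle3: "bij (cycle3 a b c)"
  by (simp add: cycle3_def bij_comp)

lemma cycle3_permutes: "a \<in> A \<Longrightarrow> b \<in> A \<Longrightarrow> c \<in> A \<Longrightarrow> cycle3 a b c permutes A"
  unfolding cycle3_def by (intro permutes_compose permutes_swap_id)

lemma evenperm_cycle3: "distinct [a, b, c] \<Longrightarrow> evenperm (cycle3 a b c)"
  by (simp add: cycle3_def evenperm_comp permutation_swap_id evenperm_swap)

lemma cycle3_in_Alt:
  "distinct [a, b, c] \<Longrightarrow> {a, b, c} \<subseteq> A \<Longrightarrow> cycle3 a b c \<in> carrier (Alt A)"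
  by (simp add: Alt_def cycle3_permutes evenperm_cycle3)

lemma cycle3_apply:
  assumes "distinct [a, b, c]"
  shows "cycle3 a b c a = b" "cycle3 a b c b = c" "cycle3 a b c c = a"
    and "x \<notin> {a, b, c} \<Longrightarrow> cycle3 a b c x = x"
  using assms by (auto simp: cycle3_def Transposition.transpose_def)

lemma cycle3_cubed: "distinct [a, b, c] \<Longrightarrow> cycle3 a b c \<circ> cycle3 a b c \<circ> cycle3 a b c = id"
  by (auto simp: cycle3_def Transposition.transpose_def fun_eq_iff)

lemma cycle3_squared: "distinct [a, b, c] \<Longrightarrow> cycle3 a b c \<circ> cycle3 a b c = cycle3 a c b"
  by (auto simp: cycle3_def Transposition.transpose_def fun_eq_iff)

lemma cycle3_inv: "distinct [a, b, c] \<Longrightarrow> inv' (cycle3 a b c) = cycle3 a c b"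
  by (rule inv_unique_comp) (auto simp: cycle3_def Transposition.transpose_def fun_eq_iff)

lemma cycle3_rotate: "distinct [a, b, c] \<Longrightarrow> cycle3 a b c = cycle3 b c a"
  by (auto simp: cycle3_def Transposition.transpose_def fun_eq_iff)

lemma conj_by_cycle3: "bij f \<Longrightarrow> conj_by f (cycle3 a b c) = cycle3 (f a) (f b) (f c)"
proof (rule ext)
  fix x assume f: "bij f"
  then obtain y where y: "x = f y" by (metis bij_pointE)
  show "conj_by f (cycle3 a b c) x = cycle3 (f a) (f b) (f c) x"
    using inj_eq[OF bij_is_inj[OF f]] f
    by (simp add: y conj_by_def cycle3_def Transposition.transpose_def)
qed

lemma carrier_Alt: "p \<in> carrier (Alt A) \<longleftrightarrow> p permutes A \<and> evenperm p"
  by (simp add: Alt_def)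

lemma perm_group_Alt: "finite (A :: 'a set) \<Longrightarrow> perm_group (carrier (Alt A))"
proof -
  assume "finite A"
  then have "permutation p" if "p permutes A" for p :: "'a \<Rightarrow> 'a"
    using that by (auto simp: permutation_permutes)
  then show ?thesis
    by (auto simp: perm_group_def carrier_Alt permutes_id permutes_bij permutes_inv
        permutes_compose evenperm_inv evenperm_comp)
qed

text \<open>A permutation is a product of transpositions, and a product of two transpositions is the
  identity, a three-cycle or a product of two three-cycles.\<close>

lemma Alt_subset_of_cycle3:
  assumes fin: "finite A" and M: "perm_group M"
    and cyc: "\<And>a b c. distinct [a, b, c] \<Longrightarrow> {a, b, c} \<subseteq> A \<Longrightarrow> cycle3 a b c \<in> M"
  shows "carrier (Alt A) \<subseteq> M"
proof -
  note cl = perm_groupD[OF M]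
  have two: "Transposition.transpose x y \<circ> Transposition.transpose a b \<in> M"
    if xy: "x \<in> A" "y \<in> A" "x \<noteq> y" and ab: "a \<in> A" "b \<in> A" "a \<noteq> b" for x y a b
  proof -
    have adj: "Transposition.transpose u v \<circ> Transposition.transpose v w \<in> M"
      if "u \<in> A" "v \<in> A" "w \<in> A" "u \<noteq> v" "v \<noteq> w" for u v w
    proof (cases "u = w")
      case True
      then show ?thesis using cl(1) by (metis transpose_commute transpose_comp_involutory)
    next
      case False
      then have "cycle3 u v w \<in> M" using that by (intro cyc) auto
      then show ?thesis by (simp add: cycle3_def)
    qed
    show ?thesis
    proof (cases "y = a")
      case True
      then show ?thesis using adj[of x y b] xy ab by simp
    next
      case False
      have "Transposition.transpose x y \<circ> Transposition.transpose a b =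
        (Transposition.transpose x y \<circ> Transposition.transpose y a) \<circ>
        (Transposition.transpose y a \<circ> Transposition.transpose a b)"
        by (simp add: fun_eq_iff transpose_commute)
      then show ?thesis using cl(4)[OF adj[of x y a] adj[of y a b]] xy ab False by simp
    qed
  qed
  \<comment> \<open>The induction adds one transposition at a time, so odd permutations are included, completed by
    any further transposition.\<close>
  have "(evenperm p \<longrightarrow> p \<in> M) \<and>
    (\<not> evenperm p \<longrightarrow> (\<forall>x\<in>A. \<forall>y\<in>A. x \<noteq> y \<longrightarrow> Transposition.transpose x y \<circ> p \<in> M))"
    if "p permutes A" for p
    using that fin
  proof (induction rule: permutes_induct)
    case id
    show ?case using cl(1) by (simp add: id_def)
  next
    case (swap a b p)
    have "permutation p" using swap fin by (auto simp: permutation_permutes)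
    then have par: "evenperm (Transposition.transpose a b \<circ> p) \<longleftrightarrow> \<not> evenperm p"
      using swap(3) by (simp add: evenperm_comp permutation_swap_id evenperm_swap)
    show ?case
    proof (cases "evenperm p")
      case True
      then have "Transposition.transpose x y \<circ> (Transposition.transpose a b \<circ> p) \<in> M"
        if "x \<in> A" "y \<in> A" "x \<noteq> y" for x y
        using cl(4)[OF two[OF that swap(1-3)], of p] swap by (simp add: o_assoc)
      then show ?thesis using par True by blast
    qed (use par swap in blast)
  qed
  then show ?thesis by (auto simp: carrier_Alt)
qed

lemma two_fresh_points:
  assumes "card A \<ge> 5"
  obtains x y where "x \<in> A" "y \<in> A" "x \<noteq> y" "x \<notin> {a, b, c}" "y \<notin> {a, b, c}"
proof -
  have fin: "finite A" using assms card.infinite by fastforce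
  have "card (A - {a, b, c}) \<ge> card A - card {a, b, c}"
    by (rule diff_card_le_card_Diff) simp
  moreover have "card {a, b, c} \<le> 3" by (simp add: card_insert_if)
  ultimately have "2 \<le> card (A - {a, b, c})" using assms by linarith
  then obtain T where "T \<subseteq> A - {a, b, c}" "card T = 2"
    by (meson obtain_subset_with_card_n)
  then show ?thesis using that by (auto simp: card_2_iff)
qed

text \<open>Double transpositions are even involutions whose commutators still include all three-cycles. Being
  involutions, they can later be separated from elements of order three.\<close>

definition double_transp :: "'a set \<Rightarrow> ('a \<Rightarrow> 'a) set"
  where "double_transp A = {Transposition.transpose a b \<circ> Transposition.transpose x y | a b x y.
    distinct [a, b, x, y] \<and> {a, b, x, y} \<subseteq> A}"

lemma double_transp_in_Alt: "g \<in> double_transp A \<Longrightarrow> g \<in> carrier (Alt A)"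
  unfolding double_transp_def carrier_Alt
  by (auto intro!: permutes_compose permutes_swap_id
      simp: evenperm_comp permutation_swap_id evenperm_swap)

lemma double_transp_involution: "g \<in> double_transp A \<Longrightarrow> g \<circ> g = id"
  unfolding double_transp_def by (auto simp: Transposition.transpose_def fun_eq_iff)

text \<open>With five points available, the involutions \<open>(a b)(x y)\<close> and \<open>(a c)(x y)\<close> multiply to a
  three-cycle; as they are involutions, their commutator is its square, again a three-cycle.\<close>

lemma cycle3_commutator:
  assumes "card A \<ge> 5" "distinct [a, b, c]" "{a, b, c} \<subseteq> A"
  obtains g h where "g \<in> double_transp A" "h \<in> double_transp A" "g \<noteq> h"
    "cycle3 a b c = commutator g h"
proof -
  obtain x y where xy: "x \<in> A" "y \<in> A" "x \<noteq> y" "x \<notin> {a, b, c}" "y \<notin> {a, b, c}"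
    using two_fresh_points[OF assms(1)] by metis
  let ?g = "Transposition.transpose a b \<circ> Transposition.transpose x y"
  let ?h = "Transposition.transpose a c \<circ> Transposition.transpose x y"
  have dist: "distinct [a, b, x, y]" "distinct [a, c, x, y]" using xy assms(2) by auto
  have g: "?g \<in> double_transp A" "?h \<in> double_transp A"
    using xy assms(2,3) unfolding double_transp_def by auto
  have inv: "inv' ?g = ?g" "inv' ?h = ?h"
    using double_transp_involution[OF g(1)] double_transp_involution[OF g(2)]
    by (auto intro: inv_unique_comp)
  have "?g \<circ> ?h = cycle3 a c b"
    using dist assms(2) by (auto simp: cycle3_def Transposition.transpose_def fun_eq_iff)
  then have "cycle3 a b c = (?g \<circ> ?h) \<circ> (?g \<circ> ?h)"
    using assms(2) cycle3_squared[of a c b] by auto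
  then have "cycle3 a b c = commutator ?g ?h"
    unfolding commutator_def inv by (simp only: o_assoc)
  moreover have "?g a \<noteq> ?h a" using dist assms(2) by (auto simp: Transposition.transpose_def)
  ultimately show ?thesis using that[OF g] by metis
qed

text \<open>This serves as perfectness of the alternating group: a group of bijections that contains
  all commutators contains the alternating group.\<close>

lemma Alt_subset_of_commutators:
  assumes "card A \<ge> 5" and M: "perm_group M"
    and comm: "\<And>g h. g \<in> double_transp A \<Longrightarrow> h \<in> double_transp A \<Longrightarrow> g \<noteq> h \<Longrightarrow> commutator g h \<in> M"
  shows "carrier (Alt A) \<subseteq> M"
proof (rule Alt_subset_of_cycle3[OF _ M])
  show "finite A" using assms(1) card.infinite by fastforce
  fix a b c assume "distinct [a, b, c]" "{a, b, c} \<subseteq> A"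
  then show "cycle3 a b c \<in> M" using cycle3_commutator[OF assms(1)] comm by metis
qed

text \<open>A homomorphism from an alternating group to permutations of a finite set has even values:
  the image of a three-cycle has trivial cube, and a permutation with trivial cube is even.\<close>

lemma Alt_hom_even:
  assumes fin: "finite A" "finite Z"
    and perm: "\<And>p. p permutes A \<Longrightarrow> h p permutes Z"
    and hom: "\<And>p q. p permutes A \<Longrightarrow> q permutes A \<Longrightarrow> h (p \<circ> q) = h p \<circ> h q"
    and p: "p \<in> carrier (Alt A)"
  shows "evenperm (h p)"
proof -
  let ?M = "{p. p permutes A \<and> evenperm (h p)}"
  have perm': "permutation (h p)" if "p permutes A" for p
    using perm[OF that] fin(2) by (auto simp: permutation_permutes)
  have "h id \<circ> h id = h id" using hom[of id id] by (simp add: permutes_id)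
  then have "h id (h id x) = h id x" for x by (metis comp_apply)
  then have hid: "h id = id"
    using inj_eq[OF permutes_inj[OF perm[OF permutes_id]]] by (simp add: fun_eq_iff)
  have "perm_group ?M"
    unfolding perm_group_def
  proof (intro conjI ballI)
    show "id \<in> ?M" by (simp add: permutes_id hid)
    fix f assume f: "f \<in> ?M"
    then show "bij f" by (auto simp: permutes_bij)
    have fi: "inv' f permutes A" using f by (simp add: permutes_inv)
    have "h (inv' f) \<circ> h f = id"
      using hom[OF fi, of f] f hid permutes_inv_o(2)[of f A] by simp
    then have "evenperm (h (inv' f))"
      using evenperm_comp[OF perm'[OF fi] perm'[of f]] f by simp
    then show "inv' f \<in> ?M" using fi by simp
    fix g assume g: "g \<in> ?M"
    show "f \<circ> g \<in> ?M"
      using f g hom[of f g] evenperm_comp[OF perm'[of f] perm'[of g]]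
      by (simp add: permutes_compose)
  qed
  moreover have "cycle3 a b c \<in> ?M" if d: "distinct [a, b, c]" "{a, b, c} \<subseteq> A" for a b c
  proof -
    let ?c = "cycle3 a b c"
    have c: "?c permutes A" using d(2) by (simp add: cycle3_permutes)
    have "h ?c \<circ> h ?c \<circ> h ?c = h (?c \<circ> ?c \<circ> ?c)" using hom c by (simp add: permutes_compose)
    then have "h ?c \<circ> h ?c \<circ> h ?c = id" by (simp add: cycle3_cubed[OF d(1)] hid)
    then have "evenperm (h ?c \<circ> h ?c \<circ> h ?c)" by simp
    then have "evenperm (h ?c)"
      using evenperm_comp perm'[OF c] permutation_compose by blast
    then show ?thesis using c by simp
  qed
  ultimately have "carrier (Alt A) \<subseteq> ?M" by (intro Alt_subset_of_cycle3[OF fin(1)]) auto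
  then show ?thesis using p by auto
qed

text \<open>The alternating group acts highly transitively: a partial injection extends to a permutation,
  whose parity can be corrected on two points outside the domain.\<close>

lemma even_extension:
  assumes fin: "finite A" and F: "F \<subseteq> A" "card F + 2 \<le> card A"
    and f: "inj_on f F" "f ` F \<subseteq> A"
  obtains s where "s \<in> carrier (Alt A)" "\<And>x. x \<in> F \<Longrightarrow> s x = f x"
proof -
  have finF: "finite F" using fin F(1) finite_subset by blast
  have "card (f ` F) = card F" using f(1) by (rule card_image)
  then have "card (A - F) = card (A - f ` F)"
    using fin finF F(1) f(2) by (simp add: card_Diff_subset)
  then obtain e where e: "bij_betw e (A - F) (A - f ` F)"
    using fin by (metis finite_Diff finite_same_card_bij)
  define s where "s x = (if x \<in> F then f x else if x \<in> A then e x else x)" for x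
  have "bij_betw s A A"
  proof -
    have "bij_betw s F (f ` F)"
      using f(1) by (subst bij_betw_cong[of F s f]) (auto simp: s_def inj_on_imp_bij_betw)
    moreover have "bij_betw s (A - F) (A - f ` F)"
      using e by (subst bij_betw_cong[of _ s e]) (auto simp: s_def)
    ultimately have "bij_betw s (F \<union> (A - F)) (f ` F \<union> (A - f ` F))"
      by (rule bij_betw_combine) auto
    moreover have "F \<union> (A - F) = A" "f ` F \<union> (A - f ` F) = A" using F f by auto
    ultimately show ?thesis by simp
  qed
  then have s: "s permutes A"
    by (rule bij_imp_permutes) (use F in \<open>auto simp: s_def\<close>)
  have "2 \<le> card (A - F)" using fin finF F by (simp add: card_Diff_subset)
  then obtain T where "T \<subseteq> A - F" "card T = 2" by (meson obtain_subset_with_card_n)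
  then obtain x y where xy: "x \<in> A - F" "y \<in> A - F" "x \<noteq> y" by (auto simp: card_2_iff)
  let ?s = "s \<circ> Transposition.transpose x y"
  have "?s permutes A" using s xy by (intro permutes_compose permutes_swap_id) auto
  moreover have "permutation s" using s fin by (auto simp: permutation_permutes)
  then have "evenperm ?s \<longleftrightarrow> \<not> evenperm s"
    using xy by (simp add: evenperm_comp permutation_swap_id evenperm_swap)
  moreover have "s z = f z" "?s z = f z" if "z \<in> F" for z
    using that xy by (auto simp: s_def Transposition.transpose_def)
  ultimately show ?thesis using that[of s] that[of ?s] s unfolding carrier_Alt by blast
qed

lemma Alt_3_transitive:
  assumes "card A \<ge> 5" "distinct [a, b, c]" "{a, b, c} \<subseteq> A" "distinct [a', b', c']" "{a', b', c'} \<subseteq> A"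
  obtains s where "s \<in> carrier (Alt A)" "s a = a'" "s b = b'" "s c = c'"
proof -
  let ?f = "\<lambda>x. if x = a then a' else if x = b then b' else c'"
  have fin: "finite A" using assms(1) card.infinite by fastforce
  obtain s where "s \<in> carrier (Alt A)" "\<And>x. x \<in> {a, b, c} \<Longrightarrow> s x = ?f x"
    by (rule even_extension[of A "{a, b, c}" ?f]) (use assms fin in \<open>auto simp: inj_on_def\<close>)
  then show ?thesis using that[of s] assms(2) by auto
qed

lemma Alt_2_transitive:
  assumes "card A \<ge> 5" "a \<noteq> b" "{a, b} \<subseteq> A" "a' \<noteq> b'" "{a', b'} \<subseteq> A"
  obtains s where "s \<in> carrier (Alt A)" "s a = a'" "s b = b'"
proof -
  let ?f = "\<lambda>x. if x = a then a' else b'"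
  have fin: "finite A" using assms(1) card.infinite by fastforce
  obtain s where "s \<in> carrier (Alt A)" "\<And>x. x \<in> {a, b} \<Longrightarrow> s x = ?f x"
    by (rule even_extension[of A "{a, b}" ?f]) (use assms fin in \<open>auto simp: inj_on_def card_insert_if\<close>)
  then show ?thesis using that[of s] assms(2) by auto
qed

lemma Alt_subset_of_pointed_cycle3:
  assumes fin: "finite A" and M: "perm_group M" and ab: "a \<in> A" "b \<in> A" "a \<noteq> b"
    and cyc: "\<And>z. z \<in> A \<Longrightarrow> z \<noteq> a \<Longrightarrow> z \<noteq> b \<Longrightarrow> cycle3 a b z \<in> M"
  shows "carrier (Alt A) \<subseteq> M"
proof (rule Alt_subset_of_cycle3[OF fin M])
  note cl = perm_groupD[OF M]
  have cyc': "cycle3 a z b \<in> M" if "z \<in> A" "z \<noteq> a" "z \<noteq> b" for z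
    using cl(3)[OF cyc[OF that]] that ab(3) by (simp add: cycle3_inv)
  have one: "cycle3 a y z \<in> M" if "y \<in> A" "z \<in> A" "distinct [a, y, z]" for y z
  proof (cases "y = b \<or> z = b")
    case True
    then show ?thesis using that cyc[of z] cyc'[of y] by auto
  next
    case False
    note ev = cycle3_apply[of a b z]
    have d: "distinct [a, b, z]" "y \<notin> {a, b, z}" using that False ab(3) by auto
    have m: "cycle3 a b z \<in> M" "cycle3 a b y \<in> M" using that False by (auto intro!: cyc)
    have "conj_by (cycle3 a b z) (conj_by (cycle3 a b z) (cycle3 a b y)) = cycle3 z a y"
      using ev(1-3)[OF d(1)] ev(4)[OF d(1,2)] by (simp add: conj_by_cycle3 bij_cycle3)
    then have "cycle3 z a y \<in> M" using cl(5)[OF m(1) cl(5)[OF m]] by simp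
    then show ?thesis using cycle3_rotate[of z a y] d by auto
  qed
  fix x y z assume d: "distinct [x, y, z]" and sub: "{x, y, z} \<subseteq> A"
  show "cycle3 x y z \<in> M"
  proof (cases "a \<in> {x, y, z}")
    case True
    then consider "a = x" | "a = y" | "a = z" by blast
    then show ?thesis
    proof cases
      case 1
      then show ?thesis using one[of y z] d sub by auto
    next
      case 2
      then show ?thesis using one[of z x] cycle3_rotate[OF d] d sub by auto
    next
      case 3
      then show ?thesis using one[of x y] cycle3_rotate[of z x y] d sub by auto
    qed
  next
    case False
    have "distinct [a, x, y]" "z \<notin> {a, x, y}" using d False by auto
    then have "conj_by (cycle3 a x y) (cycle3 a x z) = cycle3 x y z"
      using cycle3_apply[of a x y] by (simp add: conj_by_cycle3 bij_cycle3)
    moreover have "cycle3 a x y \<in> M" "cycle3 a x z \<in> M" using one d sub False by auto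
    ultimately show ?thesis using cl(5) by metis
  qed
qed

lemma transitive_cycle_exists:
  assumes "finite A"
  obtains c where "c permutes A" "\<And>x y. x \<in> A \<Longrightarrow> y \<in> A \<Longrightarrow> \<exists>n. (c ^^ n) x = y"
proof (cases "A = {}")
  case True
  then show ?thesis using that[of id] by (simp add: permutes_id)
next
  case False
  define m where "m = card A"
  have m: "m > 0" using False assms by (simp add: m_def card_gt_0_iff)
  obtain e where e: "bij_betw e {0..<m} A"
    using ex_bij_betw_nat_finite[OF assms] by (auto simp: m_def)
  define e' where "e' = the_inv_into {0..<m} e"
  have e': "e' (e i) = i" if "i < m" for i
    using e that by (simp add: e'_def the_inv_into_f_f bij_betw_def)
  define c where "c x = (if x \<in> A then e (Suc (e' x) mod m) else x)" for x
  have eA: "e i \<in> A" if "i < m" for i using e that by (auto simp: bij_betw_def)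
  have ex: "\<exists>i<m. x = e i" if "x \<in> A" for x using e that by (auto simp: bij_betw_def)
  have ce: "c (e i) = e (Suc i mod m)" if "i < m" for i using that by (simp add: c_def eA e')
  have pow: "(c ^^ n) (e i) = e ((i + n) mod m)" if "i < m" for n i
    by (induction n) (use that m ce in \<open>auto simp: mod_Suc_eq\<close>)
  have reach: "\<exists>n. (c ^^ n) x = y" if x: "x \<in> A" and y: "y \<in> A" for x y
  proof -
    obtain i j where ij: "i < m" "x = e i" "j < m" "y = e j" using ex[OF x] ex[OF y] by blast
    have "(c ^^ (m - i + j)) x = y" using pow[OF ij(1), of "m - i + j"] ij by simp
    then show ?thesis by blast
  qed
  have "A \<subseteq> c ` A"
  proof
    fix y assume y: "y \<in> A"
    then obtain j where j: "j < m" "y = e j" using ex by metis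
    let ?i = "(j + (m - 1)) mod m"
    have i: "?i < m" using m by simp
    have "Suc ?i mod m = j" using j m by (simp add: mod_Suc_eq)
    then have "c (e ?i) = y" using ce[OF i] j by simp
    then show "y \<in> c ` A" using eA[OF i] by (metis image_eqI)
  qed
  moreover have "c ` A \<subseteq> A" using eA m by (auto simp: c_def)
  ultimately have "bij_betw c A A"
    using assms by (simp add: bij_betw_def finite_surj_inj subset_antisym)
  then have "c permutes A" by (rule bij_imp_permutes) (simp add: c_def)
  then show ?thesis using that reach by blast
qed

text \<open>Conjugating the three-cycle \<open>(a b z)\<close> by a permutation \<open>t\<close> that preserves \<open>{a, b}\<close> and moves
  the other points in a single cycle gives all \<open>(a b z')\<close>, up to inversion. According to whether
  \<open>t\<close> exchanges \<open>a\<close> and \<open>b\<close> or not, its parity can be chosen even.\<close>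

lemma Alt_two_generators:
  assumes fin: "finite A" and abz: "distinct [a, b, z]" "{a, b, z} \<subseteq> A"
  obtains t where "t \<in> carrier (Alt A)"
    "\<And>M. perm_group M \<Longrightarrow> cycle3 a b z \<in> M \<Longrightarrow> t \<in> M \<Longrightarrow> carrier (Alt A) \<subseteq> M"
proof -
  obtain c where c: "c permutes (A - {a, b})"
    and reach: "\<And>x y. x \<in> A - {a, b} \<Longrightarrow> y \<in> A - {a, b} \<Longrightarrow> \<exists>n. (c ^^ n) x = y"
    using transitive_cycle_exists[of "A - {a, b}"] fin by auto
  define t where "t = (if evenperm c then c else Transposition.transpose a b \<circ> c)"
  have cA: "c permutes A" using c by (rule permutes_subset) auto
  have cab: "c a = a" "c b = b" using c by (auto simp: permutes_def)
  have "t permutes A"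
    using cA abz by (auto simp: t_def intro!: permutes_compose permutes_swap_id)
  moreover have "permutation c" using cA fin by (auto simp: permutation_permutes)
  then have "evenperm t"
    using abz(1) by (simp add: t_def evenperm_comp permutation_swap_id evenperm_swap)
  ultimately have tA: "t \<in> carrier (Alt A)" by (simp add: carrier_Alt)
  have bt: "bij t" using \<open>t permutes A\<close> by (rule permutes_bij)
  have cin: "c x \<in> A - {a, b}" if "x \<in> A - {a, b}" for x
    using permutes_in_image[OF c] that by blast
  have tc: "t x = c x" if "x \<in> A - {a, b}" for x
    using cin[OF that] by (auto simp: t_def Transposition.transpose_def)
  show ?thesis
  proof (rule that[OF tA])
    fix M assume M: "perm_group M" and g: "cycle3 a b z \<in> M" "t \<in> M"
    note cl = perm_groupD[OF M]
    have step: "cycle3 a b (c x) \<in> M" if x: "x \<in> A - {a, b}" and m: "cycle3 a b x \<in> M" for x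
    proof (cases "evenperm c")
      case True
      then show ?thesis using cl(5)[OF g(2) m] by (simp add: conj_by_cycle3 bt tc[OF x]) (simp add: t_def cab)
    next
      case False
      have "cycle3 b a (c x) \<in> M"
        using cl(5)[OF g(2) m] False by (simp add: conj_by_cycle3 bt tc[OF x]) (simp add: t_def cab)
      then have "inv' (cycle3 b a (c x)) \<in> M" by (rule cl(3))
      then show ?thesis using cin[OF x] abz(1)
        by (metis DiffE cycle3_inv cycle3_rotate distinct_length_2_or_more distinct_singleton insertCI)
    qed
    have pw: "cycle3 a b ((c ^^ n) z) \<in> M \<and> (c ^^ n) z \<in> A - {a, b}" for n
    proof (induction n)
      case 0
      then show ?case using g(1) abz by auto
    next
      case (Suc n)
      then show ?case using step[of "(c ^^ n) z"] cin[of "(c ^^ n) z"] by simp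
    qed
    show "carrier (Alt A) \<subseteq> M"
    proof (rule Alt_subset_of_pointed_cycle3[OF fin M])
      show "a \<in> A" "b \<in> A" "a \<noteq> b" using abz by auto
      fix y assume "y \<in> A" "y \<noteq> a" "y \<noteq> b"
      then obtain n where "(c ^^ n) z = y" using reach[of z y] abz by auto
      then show "cycle3 a b y \<in> M" using pw[of n] by simp
    qed
  qed
qed

section \<open>Prefix actions and tail actions on words\<close>

text \<open>All maps below are defined on all lists, not only on words over the alphabet, so that
  they are bijections of the type of lists and can be composed and inverted freely.\<close>

definition prefix_act :: "nat \<Rightarrow> ('a list \<Rightarrow> 'a list) \<Rightarrow> 'a list \<Rightarrow> 'a list"
  where "prefix_act l s w = (if l \<le> length w then s (take l w) @ drop l w else w)"

text \<open>The permutation \<open>g\<close> of pairs, acting on the last two letters of the words \<open>uxy\<close>.\<close>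

definition graft :: "'a list \<Rightarrow> ('a list \<Rightarrow> 'a list) \<Rightarrow> 'a list \<Rightarrow> 'a list"
  where "graft u g w =
    (if take (length u) w = u \<and> length w = length u + 2 then u @ g (drop (length u) w) else w)"

definition single :: "'a \<Rightarrow> ('b \<Rightarrow> 'b) \<Rightarrow> 'a \<Rightarrow> 'b \<Rightarrow> 'b"
  where "single u g = (\<lambda>v. if v = u then g else id)"

text \<open>The action of the tilde elements on words of all lengths at once: the letters \<open>d\<close> at the
  beginning are skipped, the next two letters are permuted. A word with fewer than two letters after
  the skipped ones is fixed.\<close>

fun tail_act :: "nat \<Rightarrow> (nat list \<Rightarrow> nat list) \<Rightarrow> nat list \<Rightarrow> nat list"
  where
    "tail_act d g (x # y # w) = (if x = d then d # tail_act d g (y # w) else g [x, y] @ w)"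
  | "tail_act d g w = w"

text \<open>Below each word \<open>u\<close> of length \<open>l\<close> a separate tail action, given by \<open>\<gamma> u\<close>.\<close>

definition branch_act ::
    "nat \<Rightarrow> nat \<Rightarrow> (nat list \<Rightarrow> nat list \<Rightarrow> nat list) \<Rightarrow> nat list \<Rightarrow> nat list"
  where "branch_act d l \<gamma> w =
    (if l \<le> length w then take l w @ tail_act d (\<gamma> (take l w)) (drop l w) else w)"

locale telescope =
  fixes d r :: nat
  assumes d5: "d \<ge> 5" and r2: "2 \<le> r" and rd: "r \<le> d - 3"
begin

abbreviation "W \<equiv> telescope_words d"
abbreviation "T \<equiv> tail_act d"
abbreviation "branch \<equiv> branch_act d"

definition pairs :: "nat list set"
  where "pairs = {[i, j] | i j. i \<in> {1..r} \<and> j \<in> {1..d}}"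

lemma carrier_Omega: "carrier (telescope_Omega d l) = carrier (Alt (W l))"
  by (simp add: telescope_Omega_def)

lemma carrier_B: "carrier (telescope_B d r) = carrier (Alt pairs)"
  by (simp add: telescope_B_def pairs_def)

lemma words_iff: "w \<in> W l \<longleftrightarrow> set w \<subseteq> {1..d} \<and> length w = l"
  by (simp add: telescope_words_def)

lemma finite_words: "finite (W l)"
  unfolding telescope_words_def by (rule finite_lists_length_eq) simp

lemma card_words: "card (W l) = d ^ l"
  unfolding telescope_words_def by (subst card_lists_length_eq) simp_all

lemma card_words_ge: "l \<ge> 1 \<Longrightarrow> card (W l) \<ge> 5"
  using d5 self_le_power[of d l] by (simp add: card_words)

lemma pairs_eq: "pairs = (\<lambda>(i, j). [i, j]) ` ({1..r} \<times> {1..d})"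
  by (auto simp: pairs_def)

lemma finite_pairs: "finite pairs"
  by (simp add: pairs_eq)

lemma card_pairs_ge: "card pairs \<ge> 5"
proof -
  have "card pairs = r * d"
    unfolding pairs_eq by (subst card_image) (auto simp: inj_on_def)
  then show ?thesis using mult_le_mono[OF r2 d5] by simp
qed

lemma replicate_words: "replicate k d \<in> W k"
  using d5 by (auto simp: words_iff)

text \<open>Also lists outside \<open>W l\<close> keep their length, because they are fixed.\<close>

lemma perm_words_length: "s permutes W l \<Longrightarrow> length (s u) = length u"
  using permutes_in_image[of s "W l" u] permutes_not_in[of s "W l" u] by (cases "u \<in> W l") (auto simp: words_iff)

text \<open>No pair in the support of \<open>g\<close> starts with \<open>d\<close>, since \<open>r < d\<close>. So \<open>g\<close> preserves whether a pair
  starts with \<open>d\<close>, and a second tail action takes the same branch of the recursion as the first.\<close>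

lemma perm_pairs_cases:
  assumes "g permutes pairs"
  obtains x' y' where "g [x, y] = [x', y']" "x' = d \<longleftrightarrow> x = d" "x = d \<Longrightarrow> y' = y"
    "{x, y} \<subseteq> {1..d} \<Longrightarrow> {x', y'} \<subseteq> {1..d}" "[x, y] \<in> pairs \<Longrightarrow> [x', y'] \<in> pairs"
proof (cases "[x, y] \<in> pairs")
  case True
  then have "g [x, y] \<in> pairs" using permutes_in_image[OF assms] by blast
  then obtain x' y' where xy': "g [x, y] = [x', y']" "[x', y'] \<in> pairs" by (auto simp: pairs_def)
  have "x \<noteq> d" "x' \<noteq> d" "{x', y'} \<subseteq> {1..d}" using True xy'(2) rd d5 by (auto simp: pairs_def)
  then show ?thesis using that[OF xy'(1)] xy'(2) by auto
next
  case False
  then have "g [x, y] = [x, y]" using permutes_not_in[OF assms] by blast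
  then show ?thesis using that False by auto
qed

lemma perm_pairs_length: "g permutes pairs \<Longrightarrow> length (g u) = length u"
  using permutes_in_image[of g pairs u] permutes_not_in[of g pairs u]
  by (cases "u \<in> pairs") (auto simp: pairs_def)

lemma pairs_subset_words: "pairs \<subseteq> W 2"
  using rd d5 by (auto simp: pairs_def words_iff)

lemma perm_pairs_fixes_e: "g permutes pairs \<Longrightarrow> x > r \<Longrightarrow> g (x # z) = x # z"
  by (rule permutes_not_in[of g pairs]) (auto simp: pairs_def)

subsection \<open>Prefix actions\<close>

lemma prefix_act_id [simp]: "prefix_act l id = id"
  by (auto simp: prefix_act_def fun_eq_iff)

lemma length_prefix_act: "s permutes W l \<Longrightarrow> length (prefix_act l s w) = length w"
  by (auto simp: prefix_act_def perm_words_length)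

lemma prefix_act_comp:
  "t permutes W l \<Longrightarrow> prefix_act l (s \<circ> t) = prefix_act l s \<circ> prefix_act l t"
  by (auto simp: prefix_act_def fun_eq_iff perm_words_length)

lemma prefix_act_inv_comp:
  assumes "s permutes W l"
  shows "prefix_act l s \<circ> prefix_act l (inv' s) = id" "prefix_act l (inv' s) \<circ> prefix_act l s = id"
  using assms permutes_inv[OF assms]
  by (simp_all flip: prefix_act_comp add: permutes_inv_o[OF assms])

lemma bij_prefix_act: "s permutes W l \<Longrightarrow> bij (prefix_act l s)"
  using prefix_act_inv_comp by (blast intro: o_bij)

lemma inv_prefix_act: "s permutes W l \<Longrightarrow> inv' (prefix_act l s) = prefix_act l (inv' s)"
  using prefix_act_inv_comp by (blast intro: inv_unique_comp)

lemma prefix_act_conj_by: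
  assumes "s permutes W l" "t permutes W l"
  shows "prefix_act l (conj_by s t) = conj_by (prefix_act l s) (prefix_act l t)"
  using assms permutes_inv[OF assms(1)]
  by (simp add: conj_by_def prefix_act_comp inv_prefix_act permutes_compose)

lemma prefix_act_commutator:
  assumes "s permutes W l" "t permutes W l"
  shows "prefix_act l (commutator s t) = commutator (prefix_act l s) (prefix_act l t)"
  using assms permutes_inv[OF assms(1)] permutes_inv[OF assms(2)]
  by (simp add: commutator_def prefix_act_comp inv_prefix_act permutes_compose)

lemma prefix_act_append: "length u = l \<Longrightarrow> prefix_act l s (u @ z) = s u @ z"
  by (simp add: prefix_act_def)

lemma prefix_act_supp: "prefix_act l s w \<noteq> w \<Longrightarrow> l \<le> length w \<and> s (take l w) \<noteq> take l w"
  by (auto simp: prefix_act_def split: if_splits)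

text \<open>The conjugating map is used twice: as a map on all words and as a permutation of the words of
  length \<open>m\<close>.\<close>

lemma conj_by_prefix_act_longer:
  assumes s: "s permutes W l" and t: "t permutes W m" and "l \<le> m"
  shows "conj_by (prefix_act l s) (prefix_act m t) = prefix_act m (conj_by (prefix_act l s) t)"
proof
  fix w
  have si: "inv' s permutes W l" using s by (rule permutes_inv)
  show "conj_by (prefix_act l s) (prefix_act m t) w = prefix_act m (conj_by (prefix_act l s) t) w"
  proof (cases "m \<le> length w")
    case True
    then obtain u z where w: "w = u @ z" "length u = m" by (metis append_take_drop_id length_take min.absorb2)
    have app: "prefix_act l p (v @ z) = prefix_act l p v @ z" if "length v = m" for p v
      using that \<open>l \<le> m\<close> by (simp add: prefix_act_def)
    have len: "length (prefix_act l p v) = length v" if "p permutes W l" for p v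
      using that by (rule length_prefix_act)
    show ?thesis
      using w(2) by (simp add: w(1) conj_by_def inv_prefix_act[OF s] app len[OF si] prefix_act_append
          perm_words_length[OF t])
  next
    case False
    have "length (prefix_act l (inv' s) w) = length w" by (rule length_prefix_act[OF si])
    then show ?thesis using False fun_cong[OF prefix_act_inv_comp(1)[OF s], of w]
      by (simp add: conj_by_def inv_prefix_act[OF s] prefix_act_def[of m])
  qed
qed

text \<open>On long words over the alphabet, the action on prefixes of length \<open>l\<close> is also an action on
  prefixes of any length \<open>m \<ge> l\<close>.\<close>

lemma iota_permutes:
  assumes s: "s permutes W l" and "l \<le> m"
  shows "telescope_iota d l m s permutes W m"
proof (rule bij_imp_permutes)
  have step: "telescope_iota d l m p w \<in> W m" if p: "p permutes W l" and w: "w \<in> W m" for p w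
  proof -
    have "take l w \<in> W l" using w \<open>l \<le> m\<close> by (auto simp: words_iff dest: in_set_takeD)
    then have "p (take l w) \<in> W l" using permutes_in_image[OF p] by blast
    then show ?thesis using w \<open>l \<le> m\<close>
      by (auto simp: telescope_iota_def words_iff dest: in_set_dropD)
  qed
  have inverse: "telescope_iota d l m p (telescope_iota d l m q w) = w"
    if "p permutes W l" "q permutes W l" "p \<circ> q = id" "w \<in> W m" for p q w
  proof -
    have "p (q (take l w)) = take l w" using fun_cong[OF that(3), of "take l w"] by simp
    then show ?thesis using step[OF that(2,4)] that(2,4) \<open>l \<le> m\<close>
      by (simp add: telescope_iota_def perm_words_length words_iff)
  qed
  show "bij_betw (telescope_iota d l m s) (W m) (W m)"
    by (rule bij_betw_byWitness[where f' = "telescope_iota d l m (inv' s)"])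
      (use s permutes_inv[OF s] permutes_inv_o[OF s] step inverse in \<open>auto simp del: o_apply\<close>)
qed (simp add: telescope_iota_def)

lemma iota_comp:
  assumes "t permutes W l" "l \<le> m"
  shows "telescope_iota d l m (s \<circ> t) = telescope_iota d l m s \<circ> telescope_iota d l m t"
proof
  fix w
  show "telescope_iota d l m (s \<circ> t) w = (telescope_iota d l m s \<circ> telescope_iota d l m t) w"
  proof (cases "w \<in> W m")
    case True
    then have "telescope_iota d l m t w \<in> W m"
      using permutes_in_image[OF iota_permutes[OF assms]] by blast
    then show ?thesis using True assms
      by (simp add: telescope_iota_def perm_words_length words_iff)
  qed (simp add: telescope_iota_def)
qed

lemma iota_in_Alt:
  assumes "s \<in> carrier (Alt (W l))" "l \<le> m"
  shows "telescope_iota d l m s \<in> carrier (Alt (W m))"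
  using Alt_hom_even[OF finite_words finite_words, of l "telescope_iota d l m" m s]
    assms iota_permutes iota_comp by (simp add: carrier_Alt)

lemma prefix_act_iota:
  assumes "s permutes W l" "l \<le> m" "m \<le> length w" "set w \<subseteq> {1..d}"
  shows "prefix_act m (telescope_iota d l m s) w = prefix_act l s w"
proof -
  obtain u z where w: "w = u @ z" "length u = m"
    using assms(3) by (metis append_take_drop_id length_take min.absorb2)
  then have "u \<in> W m" using assms(4) by (simp add: words_iff)
  then show ?thesis using w assms(2)
    by (simp add: prefix_act_append) (simp add: prefix_act_def telescope_iota_def)
qed

subsection \<open>Grafting permutations of pairs onto a word\<close>

lemma graft_append: "length v = 2 \<Longrightarrow> graft u g (u @ v) = u @ g v"
  by (simp add: graft_def)

lemma graft_other: "(\<And>v. length v = 2 \<Longrightarrow> w \<noteq> u @ v) \<Longrightarrow> graft u g w = w"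
  by (metis (no_types, lifting) add_diff_cancel_left' append_take_drop_id graft_def length_drop)

lemma graft_cases:
  obtains v where "length v = 2" "w = u @ v" | "\<And>g. graft u g w = w"
  using graft_other by metis

lemma graft_comp:
  assumes "h permutes pairs"
  shows "graft u (g \<circ> h) = graft u g \<circ> graft u h"
proof
  fix w show "graft u (g \<circ> h) w = (graft u g \<circ> graft u h) w"
    by (cases w u rule: graft_cases) (auto simp: graft_append perm_pairs_length[OF assms])
qed

lemma graft_id: "graft u id = id"
  by (auto simp: graft_def fun_eq_iff) (metis append_take_drop_id)

lemma graft_permutes:
  assumes g: "g permutes pairs" and u: "u \<in> W k"
  shows "graft u g permutes W (k + 2)"
proof (rule bij_imp_permutes)
  have lu: "length u = k" using u by (simp add: words_iff)
  have step: "graft u p w \<in> W (k + 2)" if p: "p permutes pairs" and w: "w \<in> W (k + 2)" for p w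
  proof (cases w u rule: graft_cases)
    case (1 v)
    then have "v \<in> W 2" using w by (auto simp: words_iff)
    then have "p v \<in> W 2"
      using permutes_in_image[OF p, of v] permutes_not_in[OF p, of v] pairs_subset_words by fastforce
    then show ?thesis using 1 u by (auto simp: graft_append words_iff)
  qed (use w in simp)
  have inverse: "graft u p (graft u q w) = w"
    if "p permutes pairs" "q permutes pairs" "p \<circ> q = id" for p q w
    using graft_comp[OF that(2), of u p] that(3) graft_id[of u] by (metis comp_apply id_apply)
  show "bij_betw (graft u g) (W (k + 2)) (W (k + 2))"
    by (rule bij_betw_byWitness[where f' = "graft u (inv' g)"])
      (use g permutes_inv[OF g] permutes_inv_o[OF g] step inverse in \<open>auto simp del: o_apply\<close>)
  fix w assume "w \<notin> W (k + 2)"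
  show "graft u g w = w"
  proof (cases w u rule: graft_cases)
    case (1 v)
    then have "v \<notin> W 2" using u \<open>w \<notin> W (k + 2)\<close> by (auto simp: words_iff)
    then have "v \<notin> pairs" using pairs_subset_words by blast
    then show ?thesis using permutes_not_in[OF g] 1 by (simp add: graft_append)
  qed simp
qed

lemma graft_in_Alt:
  assumes "g \<in> carrier (Alt pairs)" "u \<in> W k"
  shows "graft u g \<in> carrier (Alt (W (k + 2)))"
  using Alt_hom_even[OF finite_pairs finite_words, of "graft u" "k + 2" g]
    assms graft_permutes graft_comp by (simp add: carrier_Alt)

lemma graft_commutator:
  assumes "g permutes pairs" "h permutes pairs"
  shows "graft u (commutator g h) = commutator (graft u g) (graft u h)"
proof -
  have inv: "inv' (graft u p) = graft u (inv' p)" if "p permutes pairs" for p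
    by (rule inv_unique_comp)
      (simp_all add: graft_id that permutes_inv permutes_inv_o[OF that] flip: graft_comp)
  show ?thesis using assms permutes_inv[OF assms(1)] permutes_inv[OF assms(2)]
    by (simp add: commutator_def graft_comp inv permutes_compose)
qed

lemma graft_cycle3:
  assumes "length a = 2" "length b = 2" "length c = 2"
  shows "graft u (cycle3 a b c) = cycle3 (u @ a) (u @ b) (u @ c)"
proof
  fix w show "graft u (cycle3 a b c) w = cycle3 (u @ a) (u @ b) (u @ c) w"
  proof (cases w u rule: graft_cases)
    case (1 v)
    then show ?thesis by (simp add: graft_append cycle3_def Transposition.transpose_def)
  next
    case 2
    have "w = u @ v \<Longrightarrow> length v = 2 \<Longrightarrow> False" for v
      using 2[of "\<lambda>_. []"] by (simp add: graft_def)
    then show ?thesis using 2 assms by (auto simp: cycle3_def Transposition.transpose_def)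
  qed
qed

subsection \<open>Tail actions\<close>

lemma tail_act_d [simp]: "T g (d # w) = d # T g w"
  by (cases w) auto

lemma tail_act_pair: "x \<noteq> d \<Longrightarrow> T g (x # y # w) = g [x, y] @ w"
  by simp

lemma tail_act_id [simp]: "T id = id"
proof
  fix w show "T id w = id w" by (induction w rule: induct_list012) auto
qed

lemma length_tail_act: "g permutes pairs \<Longrightarrow> length (T g w) = length w"
  by (induction w rule: induct_list012) (auto simp: perm_pairs_length)

lemma tail_act_comp:
  assumes "h permutes pairs"
  shows "T (g \<circ> h) = T g \<circ> T h"
proof
  fix w show "T (g \<circ> h) w = (T g \<circ> T h) w"
  proof (induction w rule: induct_list012)
    case (3 x y w)
    show ?case
    proof (cases "x = d")
      case False
      then show ?thesis by (cases rule: perm_pairs_cases[OF assms, of x y]) (auto simp: tail_act_pair)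
    qed (use 3 in auto)
  qed auto
qed

lemma tail_act_inv_comp:
  assumes "g permutes pairs"
  shows "T g \<circ> T (inv' g) = id" "T (inv' g) \<circ> T g = id"
  using assms permutes_inv[OF assms]
  by (simp_all flip: tail_act_comp add: permutes_inv_o[OF assms])

lemma bij_tail_act: "g permutes pairs \<Longrightarrow> bij (T g)"
  using tail_act_inv_comp by (blast intro: o_bij)

lemma inv_tail_act: "g permutes pairs \<Longrightarrow> inv' (T g) = T (inv' g)"
  using tail_act_inv_comp by (blast intro: inv_unique_comp)

lemma set_tail_act:
  assumes "g permutes pairs"
  shows "set w \<subseteq> {1..d} \<Longrightarrow> set (T g w) \<subseteq> {1..d}"
proof (induction w rule: induct_list012)
  case (3 x y w)
  show ?case
  proof (cases "x = d")
    case False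
    then show ?thesis using 3 by (cases rule: perm_pairs_cases[OF assms, of x y]) auto
  qed (use 3 in auto)
qed auto

subsection \<open>Tail actions below the words of a given length\<close>

lemma branch_append: "length u = l \<Longrightarrow> branch l \<gamma> (u @ z) = u @ T (\<gamma> u) z"
  by (simp add: branch_act_def)

lemma branch_id [simp]: "branch l (\<lambda>_. id) = id"
  by (auto simp: branch_act_def fun_eq_iff)

lemma branch_comp:
  "(\<And>u. \<delta> u permutes pairs) \<Longrightarrow> branch l (\<lambda>u. \<gamma> u \<circ> \<delta> u) = branch l \<gamma> \<circ> branch l \<delta>"
  by (auto simp: branch_act_def fun_eq_iff tail_act_comp)

lemma branch_inv_comp:
  assumes "\<And>u. \<gamma> u permutes pairs"
  shows "branch l \<gamma> \<circ> branch l (\<lambda>u. inv' (\<gamma> u)) = id" "branch l (\<lambda>u. inv' (\<gamma> u)) \<circ> branch l \<gamma> = id"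
  using assms by (simp_all flip: branch_comp add: permutes_inv permutes_inv_o[OF assms])

lemma bij_branch: "(\<And>u. \<gamma> u permutes pairs) \<Longrightarrow> bij (branch l \<gamma>)"
  using branch_inv_comp by (blast intro: o_bij)

lemma inv_branch: "(\<And>u. \<gamma> u permutes pairs) \<Longrightarrow> inv' (branch l \<gamma>) = branch l (\<lambda>u. inv' (\<gamma> u))"
  using branch_inv_comp by (blast intro: inv_unique_comp)

lemma branch_commutator:
  assumes "\<And>u. \<gamma> u permutes pairs" "\<And>u. \<delta> u permutes pairs"
  shows "commutator (branch l \<gamma>) (branch l \<delta>) = branch l (\<lambda>u. commutator (\<gamma> u) (\<delta> u))"
proof -
  have "inv' (\<gamma> u) permutes pairs" "inv' (\<delta> u) permutes pairs" for u
    using assms by (simp_all add: permutes_inv)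
  then show ?thesis
    using assms by (simp add: commutator_def branch_comp inv_branch permutes_compose)
qed

text \<open>Conjugation by a permutation of the prefixes of length \<open>l\<close> moves the tail actions to other
  prefixes and does not change them.\<close>

lemma conj_by_branch:
  assumes "s permutes W l"
  shows "conj_by (prefix_act l s) (branch l \<gamma>) = branch l (\<gamma> \<circ> inv' s)"
proof
  fix w
  have len: "length (inv' s u) = length u" for u
    using perm_words_length[OF permutes_inv[OF assms]] .
  show "conj_by (prefix_act l s) (branch l \<gamma>) w = branch l (\<gamma> \<circ> inv' s) w"
    using permutes_inverses[OF assms]
    by (auto simp: conj_by_def inv_prefix_act[OF assms] prefix_act_def branch_act_def len)
qed

lemma single_perm: "g permutes pairs \<Longrightarrow> single u g v permutes pairs"
  by (simp add: single_def permutes_id)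

lemma single_comp_inv: "bij (s :: 'c \<Rightarrow> 'c) \<Longrightarrow> single u g \<circ> inv' s = single (s u) g"
proof -
  assume "bij s"
  then have "inv' s v = u \<longleftrightarrow> v = s u" for v using inv_bij_simps[of s] by auto
  then show ?thesis by (simp add: single_def fun_eq_iff)
qed

lemma branch_single_comp:
  "h permutes pairs \<Longrightarrow> branch l (single u (g \<circ> h)) = branch l (single u g) \<circ> branch l (single u h)"
  by (subst branch_comp[symmetric]) (auto simp: single_perm single_def intro!: arg_cong[of _ _ "branch l"])

lemma branch_single_inv:
  "g permutes pairs \<Longrightarrow> inv' (branch l (single u g)) = branch l (single u (inv' g))"
  by (subst inv_branch) (auto simp: single_perm single_def intro!: arg_cong[of _ _ "branch l"])

lemma branch_single_id [simp]: "branch l (single u id) = id"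
proof -
  have "branch l (single u id) = branch l (\<lambda>_. id)"
    by (rule arg_cong[of _ _ "branch l"]) (auto simp: single_def)
  then show ?thesis by simp
qed

lemma branch_0: "branch 0 (single [] g) = T g"
  by (simp add: branch_act_def single_def fun_eq_iff)

lemma prefix_act_graft_append:
  "length v = 2 \<Longrightarrow> prefix_act (length u + 2) (graft u g) (u @ v @ z) = u @ g v @ z"
  by (simp add: prefix_act_def graft_def)

lemma prefix_act_graft_supp:
  assumes "prefix_act (length u + 2) (graft u g) w \<noteq> w" "g permutes pairs"
  obtains x y z where "w = u @ x # y # z" "x \<le> r"
proof -
  have w: "length u + 2 \<le> length w" "graft u g (take (length u + 2) w) \<noteq> take (length u + 2) w"
    using prefix_act_supp[OF assms(1)] by auto
  then obtain v where v: "length v = 2" "take (length u + 2) w = u @ v"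
    by (metis graft_cases)
  then obtain x y where xy: "v = [x, y]"
    by (metis One_nat_def Suc_1 length_0_conv length_Suc_conv)
  have "g [x, y] \<noteq> [x, y]" using w(2) v xy by (simp add: graft_append)
  then have "x \<le> r" using perm_pairs_fixes_e[OF assms(2), of x "[y]"] by fastforce
  moreover have "w = (u @ [x, y]) @ drop (length u + 2) w"
    using append_take_drop_id[of "length u + 2" w] unfolding v(2) xy by (rule sym)
  then have "w = u @ x # y # drop (length u + 2) w" by simp
  ultimately show ?thesis using that by blast
qed

lemma branch_single_supp:
  assumes "branch l (single u g) w \<noteq> w" "length u = l"
  obtains z where "w = u @ z"
  using assms append_take_drop_id[of l w]
  by (metis branch_act_def id_apply single_def tail_act_id append_take_drop_id)

text \<open>The tail action below \<open>u\<close> acts on the next two letters or, if the next letter is \<open>d\<close>, starts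
  again below \<open>ud\<close>. The two factors have disjoint supports.\<close>

lemma branch_single_split:
  assumes "g permutes pairs" "length u = k"
  shows "branch k (single u g) = prefix_act (k + 2) (graft u g) \<circ> branch (k + 1) (single (u @ [d]) g)"
proof
  fix w
  show "branch k (single u g) w = (prefix_act (k + 2) (graft u g) \<circ> branch (k + 1) (single (u @ [d]) g)) w"
  proof (cases "\<exists>x y z. w = u @ x # y # z")
    case True
    then obtain x y z where w: "w = u @ x # y # z" by blast
    have "branch k (single u g) w = u @ T g (x # y # z)"
      using assms(2) by (simp add: w branch_append single_def)
    moreover have "branch (k + 1) (single (u @ [d]) g) w =
      (u @ [x]) @ T (single (u @ [d]) g (u @ [x])) (y # z)"
      using branch_append[of "u @ [x]" "k + 1"] assms(2) by (simp add: w)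
    \<comment> \<open>The grafted factor ignores words below \<open>ud\<close>, as pairs in the support of \<open>g\<close> start with a letter
      at most \<open>r\<close>.\<close>
    moreover have "prefix_act (k + 2) (graft u g) (u @ d # v) = u @ d # v" for v
    proof (rule ccontr)
      assume "prefix_act (k + 2) (graft u g) (u @ d # v) \<noteq> u @ d # v"
      then obtain x' y' z' where "u @ d # v = u @ x' # y' # z'" "x' \<le> r"
        using prefix_act_graft_supp[of u g "u @ d # v"] assms by metis
      then show False using rd d5 by simp
    qed
    moreover have "prefix_act (k + 2) (graft u g) (u @ x # y # z) = u @ g [x, y] @ z"
      using prefix_act_graft_append[of "[x, y]" u g z] assms(2) by simp
    ultimately show ?thesis by (cases "x = d") (simp_all add: w single_def)
  next
    case False
    have "prefix_act (k + 2) (graft u g) w = w"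
      using prefix_act_graft_supp[of u g w] assms False by metis
    moreover have "branch k (single u g) w = w \<and> branch (k + 1) (single (u @ [d]) g) w = w"
    proof (cases "\<exists>z. w = u @ z")
      case True
      then obtain z where w: "w = u @ z" by blast
      then have "z = [] \<or> (\<exists>x. z = [x])" using False by (metis list.exhaust)
      then show ?thesis using assms(2) by (auto simp: w branch_act_def single_def)
    next
      case False
      then show ?thesis using branch_single_supp[of k u g w] branch_single_supp[of "k + 1" "u @ [d]" g w] assms(2)
        by (metis append.assoc length_append_singleton Suc_eq_plus1)
    qed
    ultimately show ?thesis by simp
  qed
qed

section \<open>The group of the telescope acting on all words\<close>

text \<open>The generators are closed under inverses, so products with generators on the left suffice; this
  gives an induction rule with a single generator in each step.\<close>

inductive_set tower :: "(nat list \<Rightarrow> nat list) set"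
  where
    tower_id: "id \<in> tower"
  | tower_prefix: "F \<in> tower \<Longrightarrow> s \<in> carrier (Alt (W 1)) \<Longrightarrow> prefix_act 1 s \<circ> F \<in> tower"
  | tower_tail: "F \<in> tower \<Longrightarrow> g \<in> carrier (Alt pairs) \<Longrightarrow> T g \<circ> F \<in> tower"

lemma AltD: "p \<in> carrier (Alt A) \<Longrightarrow> p permutes A"
  by (simp add: carrier_Alt)

lemmas Alt_closed = perm_groupD[OF perm_group_Alt[OF finite_words]]
lemmas Alt_pairs_closed = perm_groupD[OF perm_group_Alt[OF finite_pairs]]

lemma prefix_act_in_tower: "s \<in> carrier (Alt (W 1)) \<Longrightarrow> prefix_act 1 s \<in> tower"
  using tower_prefix[OF tower_id] by simp

lemma tail_act_in_tower: "g \<in> carrier (Alt pairs) \<Longrightarrow> T g \<in> tower"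
  using tower_tail[OF tower_id] by simp

lemma perm_group_tower: "perm_group tower"
proof -
  have bij: "bij F" if "F \<in> tower" for F
    using that
    by induction (blast intro: bij_id bij_comp bij_prefix_act bij_tail_act AltD)+
  have comp: "F \<circ> G \<in> tower" if "F \<in> tower" "G \<in> tower" for F G
    using that by (induction F) (auto intro: tower.intros simp: comp_assoc simp del: One_nat_def)
  have "inv' F \<in> tower" if "F \<in> tower" for F
    using that
  proof induction
    case (tower_prefix F s)
    then have "inv' (prefix_act 1 s \<circ> F) = inv' F \<circ> prefix_act 1 (inv' s)"
      by (simp add: o_inv_distrib bij bij_prefix_act AltD inv_prefix_act)
    moreover have "inv' F \<circ> prefix_act 1 (inv' s) \<in> tower"
      using comp[OF tower_prefix.IH prefix_act_in_tower[OF Alt_closed(3)]] tower_prefix(2) by blast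
    ultimately show ?case by (simp only:)
  next
    case (tower_tail F g)
    then have "inv' (T g \<circ> F) = inv' F \<circ> T (inv' g)"
      by (simp add: o_inv_distrib bij bij_tail_act AltD inv_tail_act)
    moreover have "inv' F \<circ> T (inv' g) \<in> tower"
      using comp[OF tower_tail.IH tail_act_in_tower[OF Alt_pairs_closed(3)]] tower_tail(2) by blast
    ultimately show ?case by (simp only:)
  qed (metis inv_id tower_id)
  then show ?thesis using bij comp tower_id by (simp add: perm_group_def)
qed

lemmas tower_closed = perm_groupD[OF perm_group_tower]

lemma tower_subset:
  assumes M: "perm_group M"
    and pre: "\<And>s. s \<in> carrier (Alt (W 1)) \<Longrightarrow> prefix_act 1 s \<in> M"
    and tail: "\<And>g. g \<in> carrier (Alt pairs) \<Longrightarrow> T g \<in> M"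
  shows "tower \<subseteq> M"
proof
  note cl = perm_groupD[OF M]
  fix F assume "F \<in> tower"
  then show "F \<in> M"
  proof induction
    case tower_id show ?case by (rule cl(1))
  next
    case (tower_prefix F s)
    then show ?case using cl(4)[OF pre] by blast
  next
    case (tower_tail F g)
    then show ?case using cl(4)[OF tail] by blast
  qed
qed

lemma length_tower: "F \<in> tower \<Longrightarrow> length (F w) = length w"
  by (induction F rule: tower.induct) (simp_all add: length_prefix_act length_tail_act AltD)

lemma set_prefix_act:
  assumes "s permutes W l" "set w \<subseteq> {1..d}"
  shows "set (prefix_act l s w) \<subseteq> {1..d}"
proof (cases "l \<le> length w")
  case True
  then have "take l w \<in> W l" using assms(2) by (auto simp: words_iff dest: in_set_takeD)
  then have "s (take l w) \<in> W l" using permutes_in_image[OF assms(1)] by blast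
  then show ?thesis using True assms(2)
    by (auto simp: prefix_act_def words_iff dest: in_set_dropD)
qed (use assms in \<open>simp add: prefix_act_def\<close>)

lemma tower_words: "F \<in> tower \<Longrightarrow> w \<in> W l \<Longrightarrow> F w \<in> W l"
proof (induction F rule: tower.induct)
  case (tower_prefix F s)
  then show ?case using set_prefix_act[OF AltD, of s 1 "F w"]
    by (simp add: words_iff length_prefix_act AltD)
next
  case (tower_tail F g)
  then show ?case using set_tail_act[OF AltD, of g "F w"]
    by (simp add: words_iff length_tail_act AltD)
qed simp

text \<open>Together with the generation results for alternating groups this is the standard way to show
  that all \<open>h p\<close> lie in a group: it is enough to treat three-cycles or commutators.\<close>

lemma perm_group_vimage:
  assumes M: "perm_group M"
    and A: "finite A"
    and comp: "\<And>p q. p permutes A \<Longrightarrow> q permutes A \<Longrightarrow> h (p \<circ> q) = h p \<circ> h q"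
    and inv: "\<And>p. p permutes A \<Longrightarrow> h (inv' p) = inv' (h p)"
    and id: "h id = id"
  shows "perm_group {p. p permutes A \<and> h p \<in> M}"
  using perm_groupD[OF M]
  by (auto simp: perm_group_def permutes_id permutes_bij permutes_inv permutes_compose comp inv id)

lemma perm_group_prefix_vimage:
  "perm_group M \<Longrightarrow> perm_group {p. p permutes W l \<and> prefix_act l p \<in> M}"
  by (rule perm_group_vimage[OF _ finite_words]) (simp_all add: prefix_act_comp inv_prefix_act)

lemma perm_group_graft_vimage:
  assumes M: "perm_group M" and u: "u \<in> W k"
  shows "perm_group {g. g permutes pairs \<and> prefix_act (k + 2) (graft u g) \<in> M}"
proof (rule perm_group_vimage[OF M finite_pairs])
  fix p q assume pq: "p permutes pairs" "q permutes pairs"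
  note gr = graft_permutes[OF _ u]
  show c: "prefix_act (k + 2) (graft u (p \<circ> q)) = prefix_act (k + 2) (graft u p) \<circ> prefix_act (k + 2) (graft u q)"
    by (simp only: graft_comp[OF pq(2)] prefix_act_comp[OF gr[OF pq(2)]])
  have "inv' (graft u p) = graft u (inv' p)"
    by (rule inv_unique_comp)
      (simp_all add: graft_id pq(1) permutes_inv permutes_inv_o[OF pq(1)] flip: graft_comp)
  then show "prefix_act (k + 2) (graft u (inv' p)) = inv' (prefix_act (k + 2) (graft u p))"
    by (simp only: inv_prefix_act[OF gr[OF pq(1)]])
qed (simp add: graft_id)

text \<open>The letters \<open>r + 1\<close> and \<open>r + 2\<close> are smaller than \<open>d\<close> and do not occur as first letters of pairs.\<close>

abbreviation shift :: "nat \<Rightarrow> nat list \<Rightarrow> nat list"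
  where "shift k \<equiv> cycle3 (replicate k d @ [d]) (replicate k d @ [r + 1]) (replicate k d @ [r + 2])"

lemma shift_in_Alt: "shift k \<in> carrier (Alt (W (k + 1)))"
  using d5 rd by (intro cycle3_in_Alt) (auto simp: words_iff)

text \<open>The tail action below \<open>d\<^sup>k\<close> has a finite part, on the prefixes of length \<open>k + 2\<close>, and a
  part below \<open>d\<^bsup>k+1\<^esup>\<close>. Conjugation by the shift fixes the finite part and moves the other part below
  \<open>d\<^sup>k(r+1)\<close>, where it commutes with both parts of the second factor. So the commutator
  sees only the finite parts.\<close>

lemma shift_commutator:
  assumes g: "g permutes pairs" and h: "h permutes pairs"
  shows "commutator (conj_by (prefix_act (k + 1) (shift k)) (branch k (single (replicate k d) g)))
      (branch k (single (replicate k d) h)) =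
    prefix_act (k + 2) (graft (replicate k d) (commutator g h))"
proof -
  let ?u = "replicate k d" and ?c = "prefix_act (k + 1) (shift k)"
  let ?A = "\<lambda>g. prefix_act (k + 2) (graft ?u g)"
  let ?M = "branch (k + 1) (single (?u @ [d]) h)" and ?M' = "branch (k + 1) (single (?u @ [r + 1]) g)"
  have W: "?u \<in> W k" by (rule replicate_words)
  have c: "shift k permutes W (k + 1)" using AltD[OF shift_in_Alt] .
  have bA: "bij (?A p)" if "p permutes pairs" for p
    using bij_prefix_act graft_permutes[OF that W] by blast
  have bc: "bij ?c" using bij_prefix_act[OF c] .
  have bM: "bij ?M" "bij ?M'" using g h by (auto intro!: bij_branch single_perm)
  have suppA: "\<exists>x z. w = ?u @ x # z \<and> x \<le> r" if "?A p w \<noteq> w" "p permutes pairs" for p w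
    using prefix_act_graft_supp[of ?u p w] that by force
  have suppM: "\<exists>z. w = ?u @ x # z" if "branch (k + 1) (single (?u @ [x]) p) w \<noteq> w" for p w x
    using branch_single_supp[OF that] by force
  have commM: "?A p \<circ> branch (k + 1) (single (?u @ [x]) q) = branch (k + 1) (single (?u @ [x]) q) \<circ> ?A p"
    if pq: "p permutes pairs" "q permutes pairs" and "x > r" for p q x
  proof (rule disjoint_support_commute[OF bA[OF pq(1)] bij_branch[OF single_perm[OF pq(2)]]])
    fix w
    show "?A p w = w \<or> branch (k + 1) (single (?u @ [x]) q) w = w"
      using suppA[OF _ pq(1), of w] suppM[of x q w] \<open>x > r\<close> by force
  qed
  have commA: "?c \<circ> ?A g = ?A g \<circ> ?c"
  proof (rule disjoint_support_commute[OF bc bA[OF g]])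
    fix w
    show "?c w = w \<or> ?A g w = w"
    proof (rule disjCI)
      assume "?A g w \<noteq> w"
      then obtain x z where w: "w = ?u @ x # z" "x \<le> r" using suppA[OF _ g] by blast
      then have "shift k (?u @ [x]) = ?u @ [x]"
        using rd d5 by (intro cycle3_apply(4)) auto
      then show "?c w = w" using prefix_act_append[of "?u @ [x]" "k + 1" "shift k" z] w by simp
    qed
  qed
  have split: "branch k (single ?u p) = ?A p \<circ> branch (k + 1) (single (?u @ [d]) p)"
    if "p permutes pairs" for p
    using branch_single_split[OF that, of ?u k] by simp
  have "shift k (?u @ [d]) = ?u @ [r + 1]" using rd d5 by (intro cycle3_apply(1)) auto
  then have conjM: "conj_by ?c (branch (k + 1) (single (?u @ [d]) g)) = ?M'"
    by (simp only: conj_by_branch[OF c] single_comp_inv[OF permutes_bij[OF c]])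
  have conjA: "conj_by ?c (?A g) = ?A g"
    unfolding conj_by_def commA using bc by (simp add: fun_eq_iff)
  let ?f = "conj_by ?c (branch k (single ?u g))" and ?g = "branch k (single ?u h)"
  have f: "?f = ?A g \<circ> ?M'" unfolding split[OF g] conj_by_comp[OF bc] conjM conjA ..
  have MM: "?M \<circ> ?M' = ?M' \<circ> ?M"
  proof (rule disjoint_support_commute[OF bM])
    fix w
    show "?M w = w \<or> ?M' w = w" using suppM[of d h w] suppM[of "r + 1" g w] rd d5 by force
  qed
  have "commutator ?f ?g = commutator (?A g) (?A h)"
  proof (rule commutator_eqI)
    show "bij ?f" unfolding f using bA[OF g] bM by (simp add: bij_comp)
    show "bij ?g" unfolding split[OF h] using bA[OF h] bM by (simp add: bij_comp)
    show "bij (?M' \<circ> ?M)" using bM by (simp add: bij_comp)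
    show "?f \<circ> ?g = ?A g \<circ> ?A h \<circ> (?M' \<circ> ?M)"
      unfolding f split[OF h] using commM[OF h g, of "r + 1"] by (simp add: fun_eq_iff)
    have "r < d" using rd d5 by simp
    then have "?M (?A g x) = ?A g (?M x)" for x using fun_cong[OF commM[OF g h, of d], of x] by simp
    moreover have "?M (?M' x) = ?M' (?M x)" for x using fun_cong[OF MM, of x] by simp
    ultimately show "?g \<circ> ?f = ?A h \<circ> ?A g \<circ> (?M' \<circ> ?M)"
      unfolding f split[OF h] by (simp add: fun_eq_iff)
  qed (use bA g h in auto)
  also have "\<dots> = prefix_act (k + 2) (graft ?u (commutator g h))"
    unfolding graft_commutator[OF g h]
    by (rule prefix_act_commutator[symmetric]) (rule graft_permutes[OF _ W], fact)+
  finally show ?thesis .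
qed

text \<open>Even permutations of words of length \<open>k + 2\<close> are obtained from those of length \<open>k + 1\<close> and a single
  grafted copy of the group of pairs. The grafted three-cycles live on the two blocks \<open>u1X\<close> and
  \<open>u2X\<close>, and by 2-transitivity their conjugates are the three-cycles on any two blocks. A
  three-cycle that meets three blocks is a conjugate of one that meets two.\<close>

lemma prefix_act_Alt_step:
  assumes M: "perm_group M"
    and lower: "\<And>s. s \<in> carrier (Alt (W (k + 1))) \<Longrightarrow> prefix_act (k + 1) s \<in> M"
    and u: "u \<in> W k"
    and gr: "\<And>g. g \<in> carrier (Alt pairs) \<Longrightarrow> prefix_act (k + 2) (graft u g) \<in> M"
    and s: "s \<in> carrier (Alt (W (k + 2)))"
  shows "prefix_act (k + 2) s \<in> M"
proof -
  note cl = perm_groupD[OF M]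
  let ?M = "{p. p permutes W (k + 2) \<and> prefix_act (k + 2) p \<in> M}"
  have pg: "perm_group ?M" using perm_group_prefix_vimage[OF M] .
  have lu: "length u = k" using u by (simp add: words_iff)
  have W1: "u @ [x] \<in> W (k + 1)" if "x \<in> {1, 2}" for x
    using u that d5 by (auto simp: words_iff)
  have two: "cycle3 a b c \<in> ?M"
    if pq: "p \<in> W (k + 1)" "q \<in> W (k + 1)" "p \<noteq> q" and abc: "distinct [a, b, c]"
      and sub: "{a, b, c} \<subseteq> W (k + 2)" "butlast ` {a, b, c} \<subseteq> {p, q}" for p q a b c
  proof -
    obtain t where t: "t \<in> carrier (Alt (W (k + 1)))" "t (u @ [1]) = p" "t (u @ [2]) = q"
      by (rule Alt_2_transitive[of "W (k + 1)" "u @ [1]" "u @ [2]" p q])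
        (use pq card_words_ge[of "k + 1"] W1 in auto)
    let ?t = "prefix_act (k + 1) t"
    have tp: "t permutes W (k + 1)" using AltD[OF t(1)] .
    have ex: "\<exists>\<alpha>. \<alpha> \<in> pairs \<and> ?t (u @ \<alpha>) = v" if v: "v \<in> {a, b, c}" for v
    proof -
      have vW: "v \<in> W (k + 2)" using sub(1) v by blast
      then have v_eq: "v = butlast v @ [last v]" "last v \<in> {1..d}"
        by (auto simp: words_iff)
          (metis append_butlast_last_id in_set_butlastD last_in_set length_greater_0_conv
            atLeastAtMost_iff subset_iff zero_less_Suc)+
      have "butlast v = p \<or> butlast v = q" using sub(2) v by auto
      then have "\<exists>x\<in>{1, 2}. t (u @ [x]) = butlast v" using t(2,3) by auto
      then obtain x where x: "x \<in> {1, 2}" "t (u @ [x]) = butlast v" by blast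
      have "?t (u @ [x, last v]) = v"
        using prefix_act_append[of "u @ [x]" "k + 1" t "[last v]"] lu x v_eq(1) by simp
      moreover have "[x, last v] \<in> pairs" using x(1) v_eq(2) r2 by (auto simp: pairs_def)
      ultimately show ?thesis by blast
    qed
    obtain \<alpha> \<beta> \<gamma> where e: "\<alpha> \<in> pairs" "?t (u @ \<alpha>) = a" "\<beta> \<in> pairs" "?t (u @ \<beta>) = b"
      "\<gamma> \<in> pairs" "?t (u @ \<gamma>) = c"
      using ex[of a] ex[of b] ex[of c] by auto
    have d3: "distinct [\<alpha>, \<beta>, \<gamma>]" using abc e by auto
    have len: "length \<alpha> = 2" "length \<beta> = 2" "length \<gamma> = 2"
      using e pairs_subset_words by (auto simp: words_iff subset_iff)
    have gA: "cycle3 \<alpha> \<beta> \<gamma> \<in> carrier (Alt pairs)" using d3 e by (intro cycle3_in_Alt) auto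
    have gp: "graft u (cycle3 \<alpha> \<beta> \<gamma>) permutes W (k + 2)" using graft_permutes[OF AltD[OF gA] u] .
    have "conj_by ?t (graft u (cycle3 \<alpha> \<beta> \<gamma>)) = cycle3 a b c"
      unfolding graft_cycle3[OF len] using bij_prefix_act[OF tp] e by (simp add: conj_by_cycle3)
    moreover have "conj_by ?t (prefix_act (k + 2) (graft u (cycle3 \<alpha> \<beta> \<gamma>))) \<in> M"
      using cl(5)[OF lower[OF t(1)] gr[OF gA]] .
    ultimately have "prefix_act (k + 2) (cycle3 a b c) \<in> M"
      using conj_by_prefix_act_longer[OF tp gp] by simp
    then show ?thesis using sub(1) by (simp add: cycle3_permutes)
  qed
  have fresh: "\<exists>q\<in>W (k + 1). q \<noteq> p" for p
  proof -
    have "card (W (k + 1)) \<ge> 5" by (rule card_words_ge) simp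
    then show ?thesis using two_fresh_points[of "W (k + 1)" p p p] by (metis insertI1)
  qed
  have "carrier (Alt (W (k + 2))) \<subseteq> ?M"
  proof (rule Alt_subset_of_cycle3[OF finite_words pg])
    fix a b c assume abc: "distinct [a, b, c]" and sub: "{a, b, c} \<subseteq> W (k + 2)"
    have bW: "butlast v \<in> W (k + 1)" if "v \<in> W (k + 2)" for v
      using that by (auto simp: words_iff dest: in_set_butlastD)
    let ?p = "butlast a" and ?q = "butlast b" and ?r = "butlast c"
    have pW: "?p \<in> W (k + 1)" "?q \<in> W (k + 1)" "?r \<in> W (k + 1)" using bW sub by auto
    show "cycle3 a b c \<in> ?M"
    proof (cases "distinct [?p, ?q, ?r]")
      case False
      then obtain p q where "p \<in> W (k + 1)" "q \<in> W (k + 1)" "p \<noteq> q" "butlast ` {a, b, c} \<subseteq> {p, q}"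
        using pW fresh[of ?p] by (cases "?p = ?q"; cases "?p = ?r") auto
      then show ?thesis using two[OF _ _ _ abc sub] by blast
    next
      case True
      have mate: "\<exists>v'. v' \<in> W (k + 2) \<and> butlast v' = butlast v \<and> v' \<noteq> v" if "v \<in> W (k + 2)" for v
      proof -
        obtain x where "x \<in> {1..d}" "x \<noteq> last v" using d5
          by (metis One_nat_def atLeastAtMost_iff le_numeral_extra(4) numeral_le_one_iff
              order_trans semiring_norm(68) semiring_norm(70) one_le_numeral)
        then show ?thesis using bW[OF that]
          by (intro exI[of _ "butlast v @ [x]"]) (auto simp: words_iff, metis last_snoc)
      qed
      \<comment> \<open>With mates \<open>a'\<close> and \<open>c'\<close> in the blocks of \<open>a\<close> and \<open>c\<close>, the cycle \<open>(a' c c')\<close> conjugates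
        \<open>(a b a')\<close> to \<open>(a b c)\<close>.\<close>
      obtain a' c' where a': "a' \<in> W (k + 2)" "butlast a' = ?p" "a' \<noteq> a"
        and c': "c' \<in> W (k + 2)" "butlast c' = ?r" "c' \<noteq> c"
        using mate[of a] mate[of c] sub by auto
      have d1: "distinct [a', c, c']" and d2: "distinct [a, b, a']" using True a' c' by auto
      have "cycle3 a' c c' \<in> ?M"
        by (rule two[OF pW(1,3) _ d1]) (use True a' c' sub in auto)
      moreover have "cycle3 a b a' \<in> ?M"
        by (rule two[OF pW(1,2) _ d2]) (use True a' sub in auto)
      ultimately have "conj_by (cycle3 a' c c') (cycle3 a b a') \<in> ?M" by (rule perm_groupD(5)[OF pg])
      moreover have "conj_by (cycle3 a' c c') (cycle3 a b a') = cycle3 a b c"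
      proof -
        have "a \<notin> {a', c, c'}" "b \<notin> {a', c, c'}" using True a' c' by auto
        then show ?thesis
          using cycle3_apply(1)[OF d1] cycle3_apply(4)[OF d1] by (simp add: conj_by_cycle3 bij_cycle3)
      qed
      ultimately show ?thesis by simp
    qed
  qed
  then show ?thesis using s by blast
qed

lemma graft_in_of_commutators:
  assumes M: "perm_group M" and u: "u \<in> W k"
    and comm: "\<And>g h. g \<in> carrier (Alt pairs) \<Longrightarrow> h \<in> carrier (Alt pairs) \<Longrightarrow>
      prefix_act (k + 2) (graft u (commutator g h)) \<in> M"
    and g: "g \<in> carrier (Alt pairs)"
  shows "prefix_act (k + 2) (graft u g) \<in> M"
proof -
  have "carrier (Alt pairs) \<subseteq> {g. g permutes pairs \<and> prefix_act (k + 2) (graft u g) \<in> M}"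
    by (rule Alt_subset_of_commutators[OF card_pairs_ge perm_group_graft_vimage[OF M u]])
      (use comm double_transp_in_Alt AltD[OF Alt_pairs_closed(6)] in auto)
  then show ?thesis using g by blast
qed

text \<open>Both statements are proved by a common induction: from the tail action below \<open>d\<^sup>k\<close> the commutators
  with the shift split off the grafted part, which yields the prefix actions of the next
  length, and what remains is the tail action below \<open>d\<^bsup>k+1\<^esup>\<close>.\<close>

lemma tower_levels:
  shows tower_prefix_act: "s \<in> carrier (Alt (W (k + 1))) \<Longrightarrow> prefix_act (k + 1) s \<in> tower"
    and tower_branch_replicate:
      "g \<in> carrier (Alt pairs) \<Longrightarrow> branch k (single (replicate k d) g) \<in> tower"
proof (induction k arbitrary: s g)
  case 0
  { case 1 then show ?case using prefix_act_in_tower by simp }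
  { case 2 then show ?case using tail_act_in_tower by (simp add: branch_0) }
next
  case (Suc k)
  let ?u = "replicate k d"
  have gr: "prefix_act (k + 2) (graft ?u g) \<in> tower" if "g \<in> carrier (Alt pairs)" for g
  proof (rule graft_in_of_commutators[OF perm_group_tower replicate_words _ that])
    fix g h assume gh: "g \<in> carrier (Alt pairs)" "h \<in> carrier (Alt pairs)"
    show "prefix_act (k + 2) (graft ?u (commutator g h)) \<in> tower"
      unfolding shift_commutator[OF AltD[OF gh(1)] AltD[OF gh(2)], symmetric]
      using tower_closed(5,6) Suc(1)[OF shift_in_Alt] Suc(2)[OF gh(1)] Suc(2)[OF gh(2)] by blast
  qed
  { case 1
    then show ?case
      using prefix_act_Alt_step[OF perm_group_tower Suc(1) replicate_words gr, of s] by simp }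
  { case (2 g)
    let ?A = "prefix_act (k + 2) (graft ?u g)"
    have "bij ?A" using tower_closed(2)[OF gr[OF 2]] .
    then have "branch (k + 1) (single (?u @ [d]) g) = inv' ?A \<circ> branch k (single ?u g)"
      using branch_single_split[OF AltD[OF 2], of ?u k] by (simp add: fun_eq_iff)
    then have "branch (k + 1) (single (?u @ [d]) g) \<in> tower"
      using tower_closed(3,4) gr[OF 2] Suc(2)[OF 2] by metis
    then show ?case by (simp add: replicate_append_same[symmetric]) }
qed

lemma tower_branch_single:
  assumes "u \<in> W k" "g \<in> carrier (Alt pairs)"
  shows "branch k (single u g) \<in> tower"
proof (cases k)
  case 0
  then show ?thesis using assms tail_act_in_tower by (simp add: words_iff branch_0)
next
  case (Suc j)
  obtain s where s: "s \<in> carrier (Alt (W k))" "s (replicate k d) = u"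
    by (rule even_extension[OF finite_words, of "{replicate k d}" k "\<lambda>_. u"])
      (use assms card_words_ge[of k] Suc replicate_words[of k] in \<open>auto simp del: replicate.simps\<close>)
  have "conj_by (prefix_act k s) (branch k (single (replicate k d) g)) \<in> tower"
    using tower_closed(5)[OF tower_prefix_act[of s j] tower_branch_replicate[OF assms(2), of k]] s(1) Suc
    by simp
  then show ?thesis
    by (simp only: conj_by_branch[OF AltD[OF s(1)]] single_comp_inv[OF permutes_bij[OF AltD[OF s(1)]]] s(2))
qed

section \<open>Simplicity\<close>

text \<open>Equality modulo the direct sum.\<close>

definition fin_eq :: "(nat list \<Rightarrow> nat list) \<Rightarrow> (nat list \<Rightarrow> nat list) \<Rightarrow> bool"
  where "fin_eq F G \<longleftrightarrow> (\<exists>L. \<forall>w. set w \<subseteq> {1..d} \<longrightarrow> L \<le> length w \<longrightarrow> F w = G w)"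

text \<open>Saturated subgroups correspond to subgroups of the head.\<close>

definition saturated :: "(nat list \<Rightarrow> nat list) set \<Rightarrow> bool"
  where "saturated M \<longleftrightarrow> (\<forall>F\<in>M. \<forall>G\<in>tower. fin_eq F G \<longrightarrow> G \<in> M)"

lemma fin_eq_iota:
  assumes "s permutes W l" "l \<le> m"
  shows "fin_eq (prefix_act m (telescope_iota d l m s)) (prefix_act l s)"
  unfolding fin_eq_def using prefix_act_iota[OF assms] by blast

lemma saturated_prefix_act:
  assumes "saturated M" "l \<ge> 1" "l \<le> m" and s: "s \<in> carrier (Alt (W l))"
    and M: "\<And>t. t \<in> carrier (Alt (W m)) \<Longrightarrow> prefix_act m t \<in> M"
  shows "prefix_act l s \<in> M"
proof -
  have "prefix_act l s \<in> tower" using tower_prefix_act[of s "l - 1"] s \<open>l \<ge> 1\<close> by simp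
  moreover have "prefix_act m (telescope_iota d l m s) \<in> M"
    using M iota_in_Alt[OF s \<open>l \<le> m\<close>] .
  ultimately show ?thesis
    using assms(1) fin_eq_iota[OF AltD[OF s] \<open>l \<le> m\<close>] by (auto simp: saturated_def)
qed

subsection \<open>Local behaviour\<close>

text \<open>Elements of the tower are described by their behaviour below a word \<open>u\<close>: the prefix \<open>u\<close> is
  replaced, and the rest of the word is unchanged (rigid) or undergoes a tail action (tame).
  At a given level tameness of all words cannot be expected, since a tail action below \<open>u\<close> need be neither
  rigid nor tame below \<open>ux\<close> for \<open>x \<le> r\<close>; but it is rigid below \<open>uxy\<close>. This is the second
  alternative of \<open>tame_level\<close>, and with it the property is inherited by higher levels and by products.\<close>

definition rigid_at :: "(nat list \<Rightarrow> nat list) \<Rightarrow> nat list \<Rightarrow> bool"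
  where "rigid_at F u \<longleftrightarrow> (\<exists>v\<in>W (length u). \<forall>z. F (u @ z) = v @ z)"

definition tame_at :: "(nat list \<Rightarrow> nat list) \<Rightarrow> nat list \<Rightarrow> bool"
  where "tame_at F u \<longleftrightarrow>
    (\<exists>v\<in>W (length u). \<exists>g\<in>carrier (Alt pairs). \<forall>z. F (u @ z) = v @ T g z)"

definition tame_level :: "nat \<Rightarrow> (nat list \<Rightarrow> nat list) \<Rightarrow> bool"
  where "tame_level k F \<longleftrightarrow> (\<forall>u\<in>W k. tame_at F u \<or> (\<forall>y\<in>{1..d}. rigid_at F (u @ [y])))"

lemma id_in_Alt_pairs: "id \<in> carrier (Alt pairs)"
  by (rule Alt_pairs_closed(1))

lemma rigid_atI: "v \<in> W (length u) \<Longrightarrow> (\<And>z. F (u @ z) = v @ z) \<Longrightarrow> rigid_at F u"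
  by (auto simp: rigid_at_def)

lemma tame_atI:
  "v \<in> W (length u) \<Longrightarrow> g \<in> carrier (Alt pairs) \<Longrightarrow> (\<And>z. F (u @ z) = v @ T g z) \<Longrightarrow> tame_at F u"
  by (auto simp: tame_at_def)

lemma rigid_imp_tame: "rigid_at F u \<Longrightarrow> tame_at F u"
  unfolding rigid_at_def tame_at_def using id_in_Alt_pairs by (metis id_apply tail_act_id)

lemma snoc_words: "u \<in> W k \<Longrightarrow> y \<in> {1..d} \<Longrightarrow> u @ [y] \<in> W (Suc k)"
  by (auto simp: words_iff)

lemma words_Suc_cases:
  assumes "w \<in> W (Suc k)" obtains u y where "w = u @ [y]" "u \<in> W k" "y \<in> {1..d}"
  using assms by (cases w rule: rev_cases) (auto simp: words_iff)

lemma rigid_at_snoc: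
  assumes "rigid_at F u" "y \<in> {1..d}"
  shows "rigid_at F (u @ [y])"
proof -
  obtain v where v: "v \<in> W (length u)" "\<And>z. F (u @ z) = v @ z" using assms(1) by (auto simp: rigid_at_def)
  then show ?thesis using v(2)[of "y # _"] snoc_words[OF v(1) assms(2)]
    by (intro rigid_atI[of "v @ [y]"]) auto
qed

lemma tail_act_large:
  assumes "g permutes pairs" "x > r" "x \<noteq> d" shows "T g (x # z) = x # z"
proof (cases z)
  case (Cons y w)
  then show ?thesis using perm_pairs_fixes_e[OF assms(1,2), of "[y]"] assms(3) by simp
qed simp

lemma tame_at_snoc:
  assumes "tame_at F u" "y \<in> {1..d}"
  shows "tame_at F (u @ [y]) \<or> (\<forall>y'\<in>{1..d}. rigid_at F (u @ [y] @ [y']))"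
proof -
  obtain v g where v: "v \<in> W (length u)" "g \<in> carrier (Alt pairs)" "\<And>z. F (u @ z) = v @ T g z"
    using assms(1) by (auto simp: tame_at_def)
  have vy: "v @ [y] \<in> W (length (u @ [y]))" using snoc_words[OF v(1) assms(2)] by simp
  show ?thesis
  proof (cases "y \<le> r")
    case True
    have "rigid_at F (u @ [y] @ [y'])" if y': "y' \<in> {1..d}" for y'
    proof -
      obtain a b where ab: "g [y, y'] = [a, b]" "{y, y'} \<subseteq> {1..d} \<Longrightarrow> {a, b} \<subseteq> {1..d}"
        by (rule perm_pairs_cases[OF AltD[OF v(2)], of y y']) blast
      have "y \<noteq> d" using True rd d5 by simp
      then have "F ((u @ [y] @ [y']) @ z) = (v @ [a, b]) @ z" for z
        using v(3)[of "y # y' # z"] ab(1) by (simp add: tail_act_pair)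
      moreover have "v @ [a, b] \<in> W (length (u @ [y] @ [y']))"
        using v(1) ab(2) y' assms(2) by (auto simp: words_iff)
      ultimately show ?thesis by (metis rigid_atI)
    qed
    then show ?thesis by blast
  next
    case False
    show ?thesis
    proof (cases "y = d")
      case True
      have "tame_at F (u @ [y])" by (rule tame_atI[OF vy v(2)]) (simp add: v(3) True)
      then show ?thesis ..
    next
      case ne: False
      have "rigid_at F (u @ [y])"
        using v(3) tail_act_large[OF AltD[OF v(2)], of y] False ne by (intro rigid_atI[OF vy]) simp
      then show ?thesis using rigid_imp_tame by blast
    qed
  qed
qed

lemma tame_level_Suc:
  assumes "tame_level k F" shows "tame_level (Suc k) F"
  unfolding tame_level_def
proof
  fix w assume "w \<in> W (Suc k)"
  then obtain u y where w: "w = u @ [y]" "u \<in> W k" "y \<in> {1..d}" by (rule words_Suc_cases)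
  then consider "tame_at F u" | "rigid_at F (u @ [y])" using assms by (auto simp: tame_level_def)
  then show "tame_at F w \<or> (\<forall>y\<in>{1..d}. rigid_at F (w @ [y]))"
  proof cases
    case 1
    then show ?thesis using tame_at_snoc[OF 1 w(3)] w(1) by simp
  qed (use w(1) rigid_imp_tame in blast)
qed

lemma tame_level_mono: "k \<le> m \<Longrightarrow> tame_level k F \<Longrightarrow> tame_level m F"
  by (induction m rule: dec_induct) (auto intro: tame_level_Suc)

lemma rigid_at_comp:
  assumes "\<And>z. F (u @ z) = v @ z" "length v = length u" "rigid_at G v"
  shows "rigid_at (G \<circ> F) u"
  using assms by (auto simp: rigid_at_def)

text \<open>A tame \<open>F\<close> maps the words below \<open>u\<close> to words below some \<open>v\<close>, after a tail action. If \<open>G\<close> is tame at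
  \<open>v\<close>, tail actions are multiplied. Otherwise \<open>G\<close> is rigid one letter further down, and the next letter
  \<open>y\<close> decides: for \<open>y = d\<close> the tail action continues, for other \<open>y > r\<close> nothing happens, and for
  \<open>y \<le> r\<close> everything is rigid after one more letter.\<close>

lemma tame_level_comp:
  assumes F: "tame_level k F" and G: "tame_level k G"
  shows "tame_level (Suc k) (G \<circ> F)"
  unfolding tame_level_def
proof
  let ?G = "G \<circ> F"
  fix w assume "w \<in> W (Suc k)"
  then obtain u y where w: "w = u @ [y]" "u \<in> W k" "y \<in> {1..d}" by (rule words_Suc_cases)
  consider "tame_at F u" | "rigid_at F (u @ [y])" using F w(2,3) by (auto simp: tame_level_def)
  then show "tame_at ?G w \<or> (\<forall>y\<in>{1..d}. rigid_at ?G (w @ [y]))"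
  proof cases
    case 1
    then obtain v g where v: "v \<in> W (length u)" "g \<in> carrier (Alt pairs)" "\<And>z. F (u @ z) = v @ T g z"
      by (auto simp: tame_at_def)
    have lu: "length u = k" using w(2) by (simp add: words_iff)
    consider "tame_at G v" | "\<forall>y\<in>{1..d}. rigid_at G (v @ [y])"
      using G v(1) lu by (auto simp: tame_level_def)
    then show ?thesis
    proof cases
      case 1
      then obtain v' g' where v': "v' \<in> W (length v)" "g' \<in> carrier (Alt pairs)" "\<And>z. G (v @ z) = v' @ T g' z"
        by (auto simp: tame_at_def)
      have "tame_at ?G u"
      proof (rule tame_atI)
        show "v' \<in> W (length u)" using v' v(1) by (simp add: words_iff)
        show "g' \<circ> g \<in> carrier (Alt pairs)" using Alt_pairs_closed(4)[OF v'(2) v(2)] .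
        show "?G (u @ z) = v' @ T (g' \<circ> g) z" for z
          using v(3) v'(3) tail_act_comp[OF AltD[OF v(2)], of g'] by simp
      qed
      then show ?thesis using tame_at_snoc[OF _ w(3)] w(1) by simp
    next
      case 2
      have lv: "length v = length u" using v(1) by (simp add: words_iff)
      consider "y = d" | "y > r" "y \<noteq> d" | "y \<le> r" "y \<noteq> d" by linarith
      then show ?thesis
      proof cases
        case 1
        obtain v' where v': "v' \<in> W (length (v @ [y]))" "\<And>z. G ((v @ [y]) @ z) = v' @ z"
          using 2 w(3) unfolding rigid_at_def by blast
        have "tame_at ?G w"
        proof (rule tame_atI[OF _ v(2)])
          show "v' \<in> W (length w)" using v'(1) lv w(1) by simp
          show "?G (w @ z) = v' @ T g z" for z
            using v(3)[of "y # z"] v'(2)[of "T g z"] 1 by (simp add: w(1))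
        qed
        then show ?thesis ..
      next
        case y: 2
        have "rigid_at ?G w"
        proof (rule rigid_at_comp[of _ _ "v @ [y]"])
          show "F (w @ z) = (v @ [y]) @ z" for z
            using v(3)[of "y # z"] tail_act_large[OF AltD[OF v(2)] y] by (simp add: w(1))
          show "rigid_at G (v @ [y])" using 2 w(3) by blast
        qed (simp add: w(1) lv)
        then show ?thesis using rigid_imp_tame by blast
      next
        case y: 3
        have "rigid_at ?G (w @ [y'])" if y': "y' \<in> {1..d}" for y'
        proof -
          obtain a b where ab: "g [y, y'] = [a, b]" "{y, y'} \<subseteq> {1..d} \<Longrightarrow> {a, b} \<subseteq> {1..d}"
            by (rule perm_pairs_cases[OF AltD[OF v(2)], of y y']) blast
          have abd: "a \<in> {1..d}" "b \<in> {1..d}" using ab(2) y' w(3) by auto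
          show ?thesis
          proof (rule rigid_at_comp[of _ _ "(v @ [a]) @ [b]"])
            show "F ((w @ [y']) @ z) = ((v @ [a]) @ [b]) @ z" for z
              using v(3)[of "y # y' # z"] y(2) ab(1) by (simp add: w(1) tail_act_pair)
            show "rigid_at G ((v @ [a]) @ [b])" using rigid_at_snoc[OF _ abd(2)] 2 abd(1) by blast
          qed (simp add: w(1) lv)
        qed
        then show ?thesis by blast
      qed
    qed
  next
    case 2
    then obtain v where v: "v \<in> W (length w)" "\<And>z. F (w @ z) = v @ z" by (auto simp: rigid_at_def w(1))
    have lw: "length v = length w" "length w = Suc k" using v(1) w by (simp_all add: words_iff)
    consider "tame_at G v" | "\<forall>y\<in>{1..d}. rigid_at G (v @ [y])"
      using tame_level_Suc[OF G] v(1) lw by (auto simp: tame_level_def)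
    then show ?thesis
    proof cases
      case 1
      then have "tame_at ?G w" using v(2) lw(1) by (auto simp: tame_at_def)
      then show ?thesis ..
    next
      case 2
      have "rigid_at ?G (w @ [y'])" if "y' \<in> {1..d}" for y'
        by (rule rigid_at_comp[of _ _ "v @ [y']"]) (use v(2)[of "y' # _"] lw 2 that in auto)
      then show ?thesis by blast
    qed
  qed
qed

lemma tower_tame:
  "F \<in> tower \<Longrightarrow> \<exists>k. tame_level k F"
proof (induction F rule: tower.induct)
  case tower_id
  have "tame_at id []" using id_in_Alt_pairs by (intro tame_atI[of "[]"]) (auto simp: words_iff)
  then have "tame_level 0 id" by (auto simp: tame_level_def words_iff)
  then show ?case by blast
next
  case (tower_prefix F s)
  then obtain k where "tame_level k F" by blast
  have "rigid_at (prefix_act 1 s) u" if "u \<in> W 1" for u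
  proof (rule rigid_atI)
    show "s u \<in> W (length u)" using that permutes_in_image[OF AltD[OF tower_prefix(2)]] by (simp add: words_iff)
    show "prefix_act 1 s (u @ z) = s u @ z" for z using that by (intro prefix_act_append) (simp add: words_iff)
  qed
  then have "tame_level 1 (prefix_act 1 s)" using rigid_imp_tame by (auto simp: tame_level_def)
  then have "tame_level (Suc (max k 1)) (prefix_act 1 s \<circ> F)"
    using tame_level_comp[of "max k 1"] tame_level_mono \<open>tame_level k F\<close> by (meson max.cobounded1 max.cobounded2)
  then show ?case by blast
next
  case (tower_tail F g)
  then obtain k where "tame_level k F" by blast
  have "tame_at (T g) []" using tower_tail(2) by (intro tame_atI[of "[]"]) (auto simp: words_iff)
  then have "tame_level 0 (T g)" by (auto simp: tame_level_def words_iff)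
  then have "tame_level (Suc k) (T g \<circ> F)"
    using tame_level_comp[of k] tame_level_mono \<open>tame_level k F\<close> by (meson le0)
  then show ?case by blast
qed

text \<open>If all rigid words were fixed, then below a word \<open>u\<close> with \<open>F(uz) = v T g z\<close> the rigid word
  \<open>u(r+1)\<close> gives \<open>v = u\<close>, and the rigid words \<open>uxy\<close> give \<open>g = id\<close>. So \<open>F\<close> would fix all long words.\<close>

lemma tower_moves_rigidly:
  assumes F: "F \<in> tower" and ne: "\<not> fin_eq F id"
  obtains u v where "u \<in> W (length u)" "v \<in> W (length u)" "u \<noteq> v" "\<And>z. F (u @ z) = v @ z"
proof (rule ccontr)
  assume contra: "\<not> thesis"
  note moved = that
  have fixed: "v = u" if "u \<in> W (length u)" "v \<in> W (length u)" "\<And>z. F (u @ z) = v @ z" for u v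
    using moved[OF that(1,2) _ that(3)] contra by blast
  obtain k where k: "tame_level k F" using tower_tame[OF F] by blast
  have rig: "F (u @ z) = u @ z" if "rigid_at F u" "u \<in> W (length u)" for u z
    using that fixed[OF that(2)] unfolding rigid_at_def by metis
  have "F (u @ z) = u @ z" if u: "u \<in> W k" and z: "z \<noteq> []" "set z \<subseteq> {1..d}" for u z
  proof -
    have lu: "length u = k" using u by (simp add: words_iff)
    consider "tame_at F u" | "\<forall>y\<in>{1..d}. rigid_at F (u @ [y])" using k u by (auto simp: tame_level_def)
    then show ?thesis
    proof cases
      case 1
      then obtain v g where v: "v \<in> W (length u)" "g \<in> carrier (Alt pairs)" "\<And>z. F (u @ z) = v @ T g z"
        by (auto simp: tame_at_def)
      have gp: "g permutes pairs" using AltD[OF v(2)] .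
      have e: "r + 1 \<in> {1..d}" "r + 1 > r" "r + 1 \<noteq> d" using rd d5 by auto
      have "v @ [r + 1] = u @ [r + 1]"
      proof (rule fixed)
        show "F ((u @ [r + 1]) @ z) = (v @ [r + 1]) @ z" for z
          using v(3)[of "(r + 1) # z"] tail_act_large[OF gp e(2,3), of z] by simp
      qed (use v(1) u lu snoc_words[OF _ e(1)] in auto)
      then have vu: "v = u" by simp
      have "g [x, y] = [x, y]" if xy: "x \<in> {1..d}" "y \<in> {1..d}" for x y
      proof (cases "x = d")
        case True
        then show ?thesis using perm_pairs_fixes_e[OF gp, of d] rd d5 by simp
      next
        case False
        obtain a b where ab: "g [x, y] = [a, b]" "{x, y} \<subseteq> {1..d} \<Longrightarrow> {a, b} \<subseteq> {1..d}"
          by (rule perm_pairs_cases[OF gp, of x y]) blast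
        have "u @ [a, b] = u @ [x, y]"
        proof (rule fixed)
          show "F ((u @ [x, y]) @ z) = (u @ [a, b]) @ z" for z
            using v(3)[of "x # y # z"] False ab(1) vu by (simp add: tail_act_pair)
        qed (use u lu xy ab(2) in \<open>auto simp: words_iff\<close>)
        then show ?thesis using ab(1) by simp
      qed
      then have "T g z = z" if "set z \<subseteq> {1..d}" for z
        using that by (induction z rule: induct_list012) auto
      then show ?thesis using v(3) z vu by simp
    next
      case 2
      obtain y z' where z': "z = y # z'" using z(1) by (cases z) auto
      then have "y \<in> {1..d}" using z(2) by simp
      then show ?thesis using rig[of "u @ [y]" z'] 2 snoc_words[OF u] lu z' by simp
    qed
  qed
  then have "F w = w" if w: "set w \<subseteq> {1..d}" "Suc k \<le> length w" for w
  proof -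
    have "take k w \<in> W k" using w by (auto simp: words_iff dest: in_set_takeD)
    moreover have "drop k w \<noteq> []" "set (drop k w) \<subseteq> {1..d}" using w by (auto dest: in_set_dropD)
    ultimately show ?thesis
      using \<open>\<And>z u. \<lbrakk>u \<in> W k; z \<noteq> []; set z \<subseteq> {1..d}\<rbrakk> \<Longrightarrow> F (u @ z) = u @ z\<close>[of "take k w" "drop k w"]
      by simp
  qed
  then show False using ne by (auto simp: fin_eq_def)
qed

subsection \<open>Normal subgroups\<close>

text \<open>If \<open>n\<close> moves the support of \<open>s\<close> away from the supports of \<open>s\<close> and \<open>t\<close>, then the conjugate of \<open>s\<close> cancels
  from the double commutator.\<close>

lemma double_commutator:
  assumes "bij n" "bij s" "bij t"
    and "conj_by n s \<circ> s = s \<circ> conj_by n s" "conj_by n s \<circ> t = t \<circ> conj_by n s"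
  shows "commutator (commutator n s) t = commutator (inv' s) t"
proof (rule commutator_eqI[where h = "conj_by n s"])
  let ?q = "conj_by n s"
  have q: "bij ?q" using assms by (intro bij_conj_by)
  have c: "commutator n s = ?q \<circ> inv' s" by (simp add: commutator_def conj_by_def)
  show "bij (commutator n s)" unfolding c using q assms by (simp add: bij_comp bij_imp_bij_inv)
  show "bij (inv' s)" using assms by (simp add: bij_imp_bij_inv)
  have qs: "?q (inv' s x) = inv' s (?q x)" for x
  proof -
    have "?q x = s (?q (inv' s x))" using fun_cong[OF assms(4), of "inv' s x"] assms(2) by simp
    then show ?thesis using assms(2) by simp
  qed
  have qt: "?q (t x) = t (?q x)" for x using fun_cong[OF assms(5), of x] by simp
  show "commutator n s \<circ> t = inv' s \<circ> t \<circ> ?q" by (simp add: c fun_eq_iff qs qt)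
  show "t \<circ> commutator n s = t \<circ> inv' s \<circ> ?q" by (simp add: c fun_eq_iff qs)
qed (use assms in \<open>auto intro: bij_conj_by\<close>)

lemma commutator_in_normal:
  assumes "perm_group N" "\<And>F G. F \<in> M \<Longrightarrow> G \<in> N \<Longrightarrow> conj_by F G \<in> N"
    and "n \<in> N" "t \<in> M"
  shows "commutator n t \<in> N"
proof -
  have "commutator n t = n \<circ> conj_by t (inv' n)" by (simp add: commutator_def conj_by_def o_assoc)
  then show ?thesis using assms perm_groupD(3,4)[OF assms(1)] by metis
qed

text \<open>A commutator changes only by elements of a normal subgroup when its first entry does.\<close>

lemma commutator_mod_normal:
  assumes "bij a" "bij a'" "bij b"
  shows "commutator a b = inv' (a' \<circ> inv' a) \<circ> commutator a' b \<circ> conj_by b (a' \<circ> inv' a)"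
proof -
  have "inv' (a' \<circ> inv' a) = a \<circ> inv' a'"
    using assms by (simp add: o_inv_distrib bij_imp_bij_inv inv_inv_eq)
  then show ?thesis using assms by (simp add: commutator_def conj_by_def fun_eq_iff)
qed

theorem normal_subgroup_of_tower:
  assumes N: "perm_group N" "N \<subseteq> tower"
    and normal: "\<And>F G. F \<in> tower \<Longrightarrow> G \<in> N \<Longrightarrow> conj_by F G \<in> N"
    and sat: "saturated N"
    and n: "n \<in> N" "\<not> fin_eq n id"
  shows "N = tower"
proof -
  note cl = perm_groupD[OF N(1)]
  have nt: "n \<in> tower" using n(1) N(2) by blast
  obtain u0 v0 where uv0: "u0 \<in> W (length u0)" "v0 \<in> W (length u0)" "u0 \<noteq> v0" "\<And>z. n (u0 @ z) = v0 @ z"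
    using tower_moves_rigidly[OF nt n(2)] by blast
  have pre: "prefix_act l s \<in> N" if l: "l \<ge> 1" and s: "s \<in> carrier (Alt (W l))" for l s
  proof -
    \<comment> \<open>Padding makes the words longer than \<open>l\<close>, so that the prefix action of \<open>s\<close> is equal, on long words, to
      one of length \<open>m\<close>.\<close>
    define u v where "u = u0 @ replicate l 1" and "v = v0 @ replicate l 1"
    define m where "m = length u + 1"
    have u: "u \<in> W (length u)" "v \<in> W (length u)" "u \<noteq> v" "length v = length u"
      using uv0(1-3) d5 by (auto simp: u_def v_def words_iff)
    have nu: "n (u @ z) = v @ z" for z using uv0(4)[of "replicate l 1 @ z"] by (simp add: u_def v_def)
    let ?A = "(\<lambda>x. u @ [x]) ` {1..d}"
    let ?M = "{p. p permutes W m \<and> prefix_act m p \<in> N}"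
    have AW: "?A \<subseteq> W m" using u(1) by (auto simp: m_def words_iff)
    have cardA: "card ?A \<ge> 5" using d5 by (subst card_image) (auto simp: inj_on_def)
    have pg: "perm_group ?M" using perm_group_prefix_vimage[OF N(1)] .
    have tow: "prefix_act m p \<in> tower" if "p \<in> carrier (Alt (W m))" for p
      using tower_prefix_act that by (simp add: m_def)
    have AltA: "p \<in> carrier (Alt (W m))" if "p \<in> carrier (Alt ?A)" for p
      using that AW by (auto simp: carrier_Alt intro: permutes_subset)
    have "carrier (Alt ?A) \<subseteq> ?M"
    proof (rule Alt_subset_of_commutators[OF cardA pg])
      fix g h assume "g \<in> double_transp ?A" "h \<in> double_transp ?A"
      then have gA: "g \<in> carrier (Alt ?A)" and hA: "h \<in> carrier (Alt ?A)" by (simp_all add: double_transp_in_Alt)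
      \<comment> \<open>The double commutator inverts its inner entry, hence the inverse of \<open>g\<close>.\<close>
      let ?s = "prefix_act m (inv' g)" and ?t = "prefix_act m h"
      have giA: "inv' g \<in> carrier (Alt ?A)" using perm_groupD(3)[OF perm_group_Alt gA] by simp
      have gi: "inv' g permutes W m" and hp: "h permutes W m" and gp: "g permutes W m"
        using AltD[OF AltA[OF giA]] AltD[OF AltA[OF hA]] AltD[OF AltA[OF gA]] by auto
      have bs: "bij ?s" "bij ?t" using bij_prefix_act gi hp by blast+
      have bn: "bij n" using cl(2)[OF n(1)] .
      have supp: "\<exists>z. w = u @ z" if "prefix_act m p w \<noteq> w" "p \<in> carrier (Alt ?A)" for p w
      proof -
        have "p (take m w) \<noteq> take m w" using prefix_act_supp[OF that(1)] by blast
        then have "take m w \<in> ?A" using permutes_not_in[OF AltD[OF that(2)]] by blast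
        then obtain x where "take m w = u @ [x]" by blast
        then have "w = (u @ [x]) @ drop m w" by (metis append_take_drop_id)
        then show ?thesis by (metis append.assoc)
      qed
      have supp': "\<exists>z. w = v @ z" if "conj_by n ?s w \<noteq> w" for w
      proof -
        have "?s (inv' n w) \<noteq> inv' n w" using that bn by (auto simp: conj_by_def)
        then obtain z where "inv' n w = u @ z" using supp[OF _ giA] by blast
        then have "w = v @ z" using nu bn by (metis inv_bij_simps(2))
        then show ?thesis by blast
      qed
      have disj: "conj_by n ?s w = w \<or> prefix_act m p w = w" if "p \<in> carrier (Alt ?A)" for p w
        using supp[OF _ that, of w] supp'[of w] u(3,4) by (metis append_eq_append_conv)
      have "commutator (commutator n ?s) ?t = commutator (inv' ?s) ?t"
        by (rule double_commutator[OF bn bs])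
          (rule disjoint_support_commute[OF bij_conj_by[OF bn bs(1)]]; use bs disj giA hA in blast)+
      also have "inv' ?s = prefix_act m g"
        using inv_prefix_act[OF gi] permutes_inv_inv[OF gp] by simp
      also have "commutator (prefix_act m g) ?t = prefix_act m (commutator g h)"
        by (rule prefix_act_commutator[OF gp hp, symmetric])
      finally have "prefix_act m (commutator g h) = commutator (commutator n ?s) ?t" ..
      moreover have "commutator (commutator n ?s) ?t \<in> N"
        using commutator_in_normal[OF N(1) normal] n(1) tow[OF AltA[OF giA]] tow[OF AltA[OF hA]] by blast
      moreover have "commutator g h permutes W m"
        using AltD[OF Alt_closed(6)[OF AltA[OF gA] AltA[OF hA]]] .
      ultimately show "commutator g h \<in> ?M" by simp
    qed
    have "carrier (Alt (W m)) \<subseteq> ?M"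
    proof (rule Alt_subset_of_cycle3[OF finite_words pg])
      fix a b c assume abc: "distinct [a, b, c]" "{a, b, c} \<subseteq> W m"
      have A3: "{u @ [1], u @ [2], u @ [3]} \<subseteq> ?A" using d5 by auto
      obtain t where t: "t \<in> carrier (Alt (W m))" "t (u @ [1]) = a" "t (u @ [2]) = b" "t (u @ [3]) = c"
        by (rule Alt_3_transitive[of "W m" "u @ [1]" "u @ [2]" "u @ [3]" a b c])
          (use card_words_ge[of m] A3 AW abc in \<open>auto simp: m_def\<close>)
      let ?c = "cycle3 (u @ [1]) (u @ [2]) (u @ [3])"
      have cA: "?c \<in> carrier (Alt ?A)" using A3 by (intro cycle3_in_Alt) auto
      then have "prefix_act m ?c \<in> N" using \<open>carrier (Alt ?A) \<subseteq> ?M\<close> by blast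
      then have "conj_by (prefix_act m t) (prefix_act m ?c) \<in> N" using normal tow[OF t(1)] by blast
      then have "prefix_act m (conj_by t ?c) \<in> N"
        using prefix_act_conj_by[OF AltD[OF t(1)] AltD[OF AltA[OF cA]]] by simp
      moreover have "conj_by t ?c = cycle3 a b c"
        using t conj_by_cycle3[OF permutes_bij[OF AltD[OF t(1)]]] by simp
      ultimately show "cycle3 a b c \<in> ?M" using abc(2) by (simp add: cycle3_permutes)
    qed
    then show ?thesis
      using saturated_prefix_act[OF sat l _ s, of m] by (auto simp: m_def u_def)
  qed
  have tail: "T g \<in> N" if "g \<in> carrier (Alt pairs)" for g
  proof -
    let ?M = "{g. g permutes pairs \<and> T g \<in> N}"
    have pg: "perm_group ?M"
      by (rule perm_group_vimage[OF N(1) finite_pairs]) (simp_all add: tail_act_comp inv_tail_act)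
    have "carrier (Alt pairs) \<subseteq> ?M"
    proof (rule Alt_subset_of_commutators[OF card_pairs_ge pg])
      fix g h assume "g \<in> double_transp pairs" "h \<in> double_transp pairs"
      then have gA: "g \<in> carrier (Alt pairs)" and hA: "h \<in> carrier (Alt pairs)"
        by (simp_all add: double_transp_in_Alt)
      note gp = AltD[OF gA] and hp = AltD[OF hA]
      have cA: "commutator g h \<in> carrier (Alt pairs)" using Alt_pairs_closed(6)[OF gA hA] .
      \<comment> \<open>The shift lies in \<open>N\<close>, so modulo \<open>N\<close> conjugation by it does not change the commutator of the
        two tail actions, which thus is a prefix action modulo \<open>N\<close>.\<close>
      let ?c = "prefix_act 1 (shift 0)"
      have cN: "?c \<in> N" using pre[of 1 "shift 0"] shift_in_Alt[of 0] by simp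
      let ?a = "conj_by ?c (T g)"
      have "commutator ?a (T h) = prefix_act 2 (graft [] (commutator g h))"
        using shift_commutator[OF gp hp, of 0] by (simp add: branch_0 numeral_2_eq_2)
      also have "\<dots> \<in> N"
        using pre[of 2] graft_in_Alt[OF cA, of "[]" 0] by (simp add: words_iff numeral_2_eq_2)
      finally have 1: "commutator ?a (T h) \<in> N" .
      have bc: "bij ?c" using cl(2)[OF cN] .
      have bg: "bij (T g)" "bij (T h)" using bij_tail_act gp hp by auto
      have "commutator ?c (T g) \<in> N"
        using commutator_in_normal[OF N(1) normal cN tail_act_in_tower[OF gA]] by blast
      then have 2: "?a \<circ> inv' (T g) \<in> N" by (simp add: commutator_def conj_by_def)
      have "commutator (T g) (T h) \<in> N"
        unfolding commutator_mod_normal[OF bg(1) bij_conj_by[OF bc bg(1)] bg(2)]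
        by (rule cl(4)[OF cl(4)[OF cl(3)[OF 2] 1] normal[OF tail_act_in_tower[OF hA] 2]])
      moreover have "commutator (T g) (T h) = T (commutator g h)"
        using gp hp permutes_inv[OF gp] permutes_inv[OF hp]
        by (simp add: commutator_def tail_act_comp inv_tail_act permutes_compose)
      ultimately show "commutator g h \<in> ?M" using AltD[OF cA] by simp
    qed
    then show ?thesis using that by blast
  qed
  have "tower \<subseteq> N" using tower_subset[OF N(1)] pre[of 1] tail by blast
  then show ?thesis using N(2) by blast
qed

section \<open>Two generators\<close>

lemma tower_branch:
  assumes "finite S" "S \<subseteq> W l" "\<And>u. u \<in> S \<Longrightarrow> \<gamma> u \<in> carrier (Alt pairs)" "\<And>u. u \<notin> S \<Longrightarrow> \<gamma> u = id"
  shows "branch l \<gamma> \<in> tower"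
  using assms
proof (induction S arbitrary: \<gamma>)
  case empty
  then have "\<gamma> u = id" for u by blast
  then have "\<gamma> = (\<lambda>_. id)" by (rule ext)
  then show ?case using tower_id by (simp only: branch_id)
next
  case (insert u S)
  let ?\<delta> = "\<gamma>(u := id)"
  have IH: "branch l ?\<delta> \<in> tower" using insert by (intro insert.IH) auto
  have perm: "?\<delta> v permutes pairs" for v
    using insert.prems(2,3) AltD by (cases "v \<in> S") (auto simp: permutes_id[unfolded id_def])
  have "\<gamma> = (\<lambda>v. single u (\<gamma> u) v \<circ> ?\<delta> v)" by (auto simp: single_def)
  then have eq: "branch l \<gamma> = branch l (single u (\<gamma> u)) \<circ> branch l ?\<delta>"
    using branch_comp[of ?\<delta> l "single u (\<gamma> u)", OF perm] by simp
  have "branch l (single u (\<gamma> u)) \<in> tower" using insert.prems by (intro tower_branch_single) auto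
  then show ?case unfolding eq using IH by (rule tower_closed(4))
qed

text \<open>The element \<open>\<tau>\<close> carries each double transposition \<open>g\<close> of pairs below the word \<open>f g\<close>. Once the even
  permutations of prefixes are available, conjugating \<open>\<tau>\<close> by a three-cycle \<open>\<omega>\<close> on \<open>f g\<close>, \<open>f h\<close> and the
  unused word \<open>p0\<close> puts \<open>g\<close> below \<open>f h\<close>, \<open>h\<close> below \<open>p0\<close> and leaves the rest. So the commutator with \<open>\<tau>\<close> is the
  commutator of \<open>g\<close> and \<open>h\<close> below \<open>f h\<close> alone. These commutators generate the group of pairs below a
  single word, and splitting backwards leads up to the tail actions.\<close>

theorem tower_two_generators:
  obtains x y where "x \<in> tower" "y \<in> tower"
    "\<And>M. perm_group M \<Longrightarrow> saturated M \<Longrightarrow> x \<in> M \<Longrightarrow> y \<in> M \<Longrightarrow> tower \<subseteq> M"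
proof -
  let ?D = "double_transp pairs"
  \<comment> \<open>Large enough for \<open>X\<^sup>l\<close> to contain a word for each double transposition and one more, \<open>p0\<close>.\<close>
  define l where "l = card ?D + 2"
  have finD: "finite ?D"
    using finite_permutations[OF finite_pairs]
    by (rule finite_subset[rotated]) (auto dest: double_transp_in_Alt AltD)
  define p0 where "p0 = replicate l (1::nat)"
  have p0: "p0 \<in> W l" using d5 by (auto simp: p0_def words_iff)
  have "l < 2 ^ l" by (rule less_exp)
  also have "(2::nat) ^ l \<le> d ^ l" using d5 by (intro power_mono) auto
  finally have "card ?D \<le> card (W l - {p0})"
    using p0 by (simp add: card_words finite_words l_def)
  then obtain f where f: "f ` ?D \<subseteq> W l - {p0}" "inj_on f ?D"
    using card_le_inj[OF finD] finite_words by (metis finite_Diff)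
  define \<gamma> where "\<gamma> p = (if p \<in> f ` ?D then the_inv_into ?D f p else id)" for p
  have \<gamma>f: "\<gamma> (f g) = g" if "g \<in> ?D" for g
    using that f(2) by (simp add: \<gamma>_def the_inv_into_f_f)
  have \<gamma>id: "\<gamma> p = id" if "p \<notin> f ` ?D" for p using that by (simp add: \<gamma>_def)
  have \<gamma>p0: "\<gamma> p0 = id" using f(1) by (intro \<gamma>id) auto
  have \<gamma>D: "\<gamma> p \<in> ?D \<or> \<gamma> p = id" for p using \<gamma>f \<gamma>id by (cases "p \<in> f ` ?D") auto
  have \<gamma>A: "\<gamma> p \<in> carrier (Alt pairs)" for p using \<gamma>D[of p] double_transp_in_Alt id_in_Alt_pairs by auto
  have \<gamma>p: "\<gamma> p permutes pairs" for p using AltD[OF \<gamma>A] .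
  have \<gamma>\<gamma>: "\<gamma> p \<circ> \<gamma> p = id" for p using \<gamma>D[of p] double_transp_involution by auto
  define \<tau> where "\<tau> = branch l \<gamma>"
  have \<tau>t: "\<tau> \<in> tower"
    unfolding \<tau>_def by (rule tower_branch[of "f ` ?D"]) (use finD f(1) \<gamma>A \<gamma>id in auto)
  have "\<tau> \<circ> \<tau> = branch l (\<lambda>u. \<gamma> u \<circ> \<gamma> u)" unfolding \<tau>_def by (rule branch_comp[OF \<gamma>p, symmetric])
  then have \<tau>\<tau>: "\<tau> \<circ> \<tau> = id" by (simp add: \<gamma>\<gamma>)
  let ?a = "p0 @ [1]" and ?b = "p0 @ [2]" and ?c = "p0 @ [3]"
  let ?W = "W (l + 1)"
  let ?\<alpha> = "cycle3 ?a ?b ?c"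
  have abc: "distinct [?a, ?b, ?c]" by simp
  have abcW: "{?a, ?b, ?c} \<subseteq> ?W" using snoc_words[OF p0] d5 by auto
  have \<alpha>A: "?\<alpha> \<in> carrier (Alt ?W)" using cycle3_in_Alt[OF abc abcW] .
  obtain t where t: "t \<in> carrier (Alt ?W)"
    "\<And>M. perm_group M \<Longrightarrow> ?\<alpha> \<in> M \<Longrightarrow> t \<in> M \<Longrightarrow> carrier (Alt ?W) \<subseteq> M"
    using Alt_two_generators[OF finite_words abc abcW] by blast
  define A where "A = prefix_act (l + 1) ?\<alpha>"
  have At: "A \<in> tower" unfolding A_def by (rule tower_prefix_act[OF \<alpha>A])
  have "A \<circ> A \<circ> A = prefix_act (l + 1) (?\<alpha> \<circ> ?\<alpha> \<circ> ?\<alpha>)"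
    unfolding A_def by (simp only: prefix_act_comp[OF AltD[OF \<alpha>A]])
  then have AAA: "A \<circ> A \<circ> A = id" by (simp only: cycle3_cubed[OF abc] prefix_act_id)
  have A\<tau>: "A \<circ> \<tau> = \<tau> \<circ> A"
  proof (rule disjoint_support_commute)
    show "bij A" "bij \<tau>" using tower_closed(2) At \<tau>t by auto
    fix w
    show "A w = w \<or> \<tau> w = w"
    proof (rule disjCI)
      assume "\<tau> w \<noteq> w"
      have "take l w \<noteq> p0"
      proof
        assume eq: "take l w = p0"
        have "\<tau> w = w"
          unfolding \<tau>_def branch_act_def eq \<gamma>p0 tail_act_id id_apply
          using append_take_drop_id[of l w, unfolded eq] by (simp only: if_cancel)
        then show False using \<open>\<tau> w \<noteq> w\<close> by blast
      qed
      moreover have "take l w = p0" if "take (l + 1) w = p0 @ [z]" for z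
      proof -
        have "take l (take (l + 1) w) = take l (p0 @ [z])" using that by simp
        then show ?thesis using p0 by (simp add: words_iff)
      qed
      ultimately have "take (l + 1) w \<notin> {?a, ?b, ?c}" by blast
      then have "?\<alpha> (take (l + 1) w) = take (l + 1) w" by (rule cycle3_apply(4)[OF abc])
      then show "A w = w" by (simp add: A_def prefix_act_def)
    qed
  qed
  define x where "x = A \<circ> \<tau>"
  define y where "y = prefix_act (l + 1) t"
  \<comment> \<open>The factors of \<open>x\<close> commute and have orders three and two, so both are powers of \<open>x\<close>.\<close>
  have x3: "x \<circ> x \<circ> x = \<tau>"
  proof
    fix w
    have 1: "A (A (A v)) = v" "\<tau> (\<tau> v) = v" "\<tau> (A v) = A (\<tau> v)" for v
      using fun_cong[OF AAA, of v] fun_cong[OF \<tau>\<tau>, of v] fun_cong[OF A\<tau>, of v] by simp_all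
    show "(x \<circ> x \<circ> x) w = \<tau> w" by (simp add: x_def 1)
  qed
  have xA: "x \<circ> \<tau> = A" unfolding x_def comp_assoc \<tau>\<tau> by simp
  have "x \<in> tower" unfolding x_def using tower_closed(4)[OF At \<tau>t] .
  moreover have "y \<in> tower" unfolding y_def by (rule tower_prefix_act[OF t(1)])
  moreover have "tower \<subseteq> M" if M: "perm_group M" "saturated M" and xy: "x \<in> M" "y \<in> M" for M
  proof -
    note cl = perm_groupD[OF M(1)]
    have \<tau>M: "\<tau> \<in> M" using cl(4)[OF cl(4)[OF xy(1) xy(1)] xy(1)] x3 by simp
    have AM: "A \<in> M" using cl(4)[OF xy(1) \<tau>M] xA by simp
    have "carrier (Alt ?W) \<subseteq> {p. p permutes ?W \<and> prefix_act (l + 1) p \<in> M}"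
      by (rule t(2)[OF perm_group_prefix_vimage[OF M(1)]])
        (use AM xy(2) AltD[OF \<alpha>A] AltD[OF t(1)] in \<open>auto simp: A_def y_def\<close>)
    then have pre: "prefix_act j s \<in> M" if "1 \<le> j" "j \<le> l + 1" "s \<in> carrier (Alt (W j))" for j s
      using saturated_prefix_act[OF M(2) that] by blast
    let ?u = "replicate l d"
    have comm: "branch l (single ?u (commutator g h)) \<in> M" if gh: "g \<in> ?D" "h \<in> ?D" "g \<noteq> h" for g h
    proof -
      let ?\<omega> = "cycle3 (f g) (f h) p0"
      have fgh: "f g \<noteq> f h" "f g \<noteq> p0" "f h \<noteq> p0" "f g \<in> W l" "f h \<in> W l"
        using f gh by (auto simp: inj_on_def)
      then have d3: "distinct [f g, f h, p0]" "distinct [f g, p0, f h]" by auto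
      have \<omega>A: "?\<omega> \<in> carrier (Alt (W l))" using cycle3_in_Alt[OF d3(1)] fgh p0 by auto
      have \<omega>M: "prefix_act l ?\<omega> \<in> M" using pre[OF _ _ \<omega>A] by (simp add: l_def)
      have gp: "g permutes pairs" "h permutes pairs" using AltD[OF double_transp_in_Alt] gh by auto
      have "commutator (conj_by (prefix_act l ?\<omega>) \<tau>) \<tau> =
          branch l (\<lambda>u. commutator (\<gamma> (inv' ?\<omega> u)) (\<gamma> u))"
        unfolding \<tau>_def conj_by_branch[OF AltD[OF \<omega>A]]
        by (subst branch_commutator) (auto simp: \<gamma>p)
      also have "(\<lambda>u. commutator (\<gamma> (inv' ?\<omega> u)) (\<gamma> u)) = single (f h) (commutator g h)"
      proof
        fix u
        have self: "commutator p p = id" if "p permutes pairs" for p :: "nat list \<Rightarrow> nat list"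
          using permutes_inverses[OF that] by (simp add: commutator_def fun_eq_iff)
        have triv: "commutator id p = id" "commutator p id = id" if "p permutes pairs" for p :: "nat list \<Rightarrow> nat list"
          using permutes_inverses[OF that] by (simp_all add: commutator_def fun_eq_iff)
        note ev = cycle3_apply[OF d3(2)]
        consider "u = f h" | "u = f g" | "u = p0" | "u \<notin> {f g, p0, f h}" by blast
        then show "commutator (\<gamma> (inv' ?\<omega> u)) (\<gamma> u) = single (f h) (commutator g h) u"
          unfolding cycle3_inv[OF d3(1)]
        proof cases
          case 1
          then show "commutator (\<gamma> (cycle3 (f g) p0 (f h) u)) (\<gamma> u) = single (f h) (commutator g h) u"
            using ev(3) \<gamma>f gh by (simp add: single_def)
        next
          case 2
          then show "commutator (\<gamma> (cycle3 (f g) p0 (f h) u)) (\<gamma> u) = single (f h) (commutator g h) u"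
            using ev(1) \<gamma>f gh fgh triv(1)[OF gp(1)] \<gamma>p0 by (simp add: single_def)
        next
          case 3
          then show "commutator (\<gamma> (cycle3 (f g) p0 (f h) u)) (\<gamma> u) = single (f h) (commutator g h) u"
            using ev(2) \<gamma>f gh fgh triv(2)[OF gp(2)] \<gamma>p0 by (simp add: single_def)
        next
          case 4
          then show "commutator (\<gamma> (cycle3 (f g) p0 (f h) u)) (\<gamma> u) = single (f h) (commutator g h) u"
            using ev(4) self[OF \<gamma>p] by (simp add: single_def)
        qed
      qed
      finally have "branch l (single (f h) (commutator g h)) \<in> M"
        using cl(6)[OF cl(5)[OF \<omega>M \<tau>M] \<tau>M] by simp
      moreover obtain s where s: "s \<in> carrier (Alt (W l))" "s (f h) = ?u"
        by (rule even_extension[OF finite_words, of "{f h}" l "\<lambda>_. ?u"])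
          (use fgh replicate_words[of l] card_words_ge[of l] in \<open>auto simp: l_def\<close>)
      ultimately have "conj_by (prefix_act l s) (branch l (single (f h) (commutator g h))) \<in> M"
        using cl(5)[OF pre[OF _ _ s(1)]] by (simp add: l_def)
      then show ?thesis
        by (simp only: conj_by_branch[OF AltD[OF s(1)]] single_comp_inv[OF permutes_bij[OF AltD[OF s(1)]]] s(2))
    qed
    let ?N = "{g. g permutes pairs \<and> branch l (single ?u g) \<in> M}"
    have "perm_group ?N"
      by (rule perm_group_vimage[OF M(1) finite_pairs]) (simp_all add: branch_single_comp branch_single_inv)
    then have "carrier (Alt pairs) \<subseteq> ?N"
    proof (rule Alt_subset_of_commutators[OF card_pairs_ge])
      fix g h assume gh: "g \<in> ?D" "h \<in> ?D" "g \<noteq> h"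
      then show "commutator g h \<in> ?N"
        using comm AltD[OF Alt_pairs_closed(6)[OF double_transp_in_Alt double_transp_in_Alt]] by blast
    qed
    then have top: "branch l (single ?u g) \<in> M" if "g \<in> carrier (Alt pairs)" for g using that by blast
    \<comment> \<open>The step from \<open>j + 1\<close> to \<open>j\<close> needs permutations of words of length \<open>j + 2 \<le> l + 1\<close>; this is why
      \<open>\<alpha>\<close> and \<open>t\<close> act on words of length \<open>l + 1\<close> while \<open>\<tau>\<close> acts below words of length \<open>l\<close>.\<close>
    have down: "branch j (single (replicate j d) g) \<in> M" if g: "g \<in> carrier (Alt pairs)" and "j \<le> l" for g j
      using \<open>j \<le> l\<close>
    proof (induction j rule: inc_induct)
      case base
      show ?case using top[OF g] .
    next
      case (step j)
      have "prefix_act (j + 2) (graft (replicate j d) g) \<in> M"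
        using pre[of "j + 2"] graft_in_Alt[OF g replicate_words[of j]] step(2) by simp
      moreover have "branch (j + 1) (single (replicate j d @ [d]) g) \<in> M"
        using step(3) by (simp add: replicate_append_same)
      ultimately show ?case
        unfolding branch_single_split[OF AltD[OF g] length_replicate] by (rule cl(4))
    qed
    show ?thesis
    proof (rule tower_subset[OF M(1)])
      show "prefix_act 1 s \<in> M" if "s \<in> carrier (Alt (W 1))" for s using pre[of 1 s] that by simp
      show "T g \<in> M" if "g \<in> carrier (Alt pairs)" for g using down[OF that, of 0] by (simp add: branch_0)
    qed
  qed
  ultimately show ?thesis using that by blast
qed

section \<open>Infinitely many classes\<close>

text \<open>Three-cycles at different depths below \<open>d, d, d, \<dots>\<close>.\<close>

definition probe :: "nat \<Rightarrow> nat list \<Rightarrow> nat list"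
  where "probe i = prefix_act (i + 1)
    (cycle3 (replicate i d @ [1]) (replicate i d @ [2]) (replicate i d @ [3]))"

lemma probe_in_tower: "probe i \<in> tower"
  unfolding probe_def using d5 snoc_words[OF replicate_words]
  by (intro tower_prefix_act cycle3_in_Alt) auto

lemma probe_not_fin_eq:
  assumes "i < j" shows "\<not> fin_eq (probe i) (probe j)"
proof
  assume "fin_eq (probe i) (probe j)"
  then obtain L where L: "\<And>w. set w \<subseteq> {1..d} \<Longrightarrow> L \<le> length w \<Longrightarrow> probe i w = probe j w"
    by (auto simp: fin_eq_def)
  \<comment> \<open>A long word that leaves the \<open>d\<close>-branch after \<open>i\<close> letters is moved by \<open>probe i\<close> only.\<close>
  let ?w = "(replicate i d @ [1]) @ replicate (L + j) 1"
  have "probe i ?w = (replicate i d @ [2]) @ replicate (L + j) 1"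
    unfolding probe_def by (subst prefix_act_append) (simp_all add: cycle3_apply(1))
  moreover have "probe j ?w = ?w"
  proof -
    have "take (j + 1) ?w ! i = 1" using assms by (simp add: nth_append)
    moreover have "(replicate j d @ [x]) ! i = d" for x using assms by (simp add: nth_append)
    ultimately have "take (j + 1) ?w \<notin> {replicate j d @ [1], replicate j d @ [2], replicate j d @ [3]}"
      using d5 by (metis insertE empty_iff numeral_le_one_iff semiring_norm(70))
    then have "cycle3 (replicate j d @ [1]) (replicate j d @ [2]) (replicate j d @ [3]) (take (j + 1) ?w)
      = take (j + 1) ?w" by (intro cycle3_apply(4)) auto
    then show ?thesis by (simp only: probe_def prefix_act_def append_take_drop_id if_cancel)
  qed
  moreover have "probe i ?w = probe j ?w" using d5 by (intro L) auto
  ultimately show False by simp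
qed

lemma fin_eq_sym: assumes "fin_eq F G" shows "fin_eq G F"
proof -
  obtain L where "\<And>w. set w \<subseteq> {1..d} \<Longrightarrow> L \<le> length w \<Longrightarrow> F w = G w"
    using assms by (auto simp: fin_eq_def)
  then have "\<forall>w. set w \<subseteq> {1..d} \<longrightarrow> L \<le> length w \<longrightarrow> G w = F w" by simp
  then show ?thesis unfolding fin_eq_def by blast
qed

lemma probe_fin_eq_iff: "fin_eq (probe i) (probe j) \<longleftrightarrow> i = j"
proof
  assume eq: "fin_eq (probe i) (probe j)"
  then have "\<not> i < j" by (metis probe_not_fin_eq)
  moreover have "\<not> j < i" using fin_eq_sym[OF eq] by (metis probe_not_fin_eq)
  ultimately show "i = j" by linarith
qed (simp add: fin_eq_def)

section \<open>The head of the telescope\<close>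

text \<open>The passage from maps on all words to families of permutations. Lists with letters
  outside the alphabet are removed here.\<close>

definition level :: "nat \<Rightarrow> (nat list \<Rightarrow> nat list) \<Rightarrow> nat list \<Rightarrow> nat list"
  where "level i F = (\<lambda>w. if w \<in> W i then F w else w)"

definition levels :: "(nat list \<Rightarrow> nat list) \<Rightarrow> nat \<Rightarrow> nat list \<Rightarrow> nat list"
  where "levels F = (\<lambda>i\<in>{1..}. level i F)"

definition tower_monoid :: "(nat list \<Rightarrow> nat list) monoid"
  where "tower_monoid = \<lparr>carrier = tower, monoid.mult = (\<circ>), one = id\<rparr>"

abbreviation "P \<equiv> telescope_P d"
abbreviation "G \<equiv> telescope_group d r"
abbreviation "S \<equiv> carrier (sum_group {1..} (telescope_Omega d))"

lemma level_comp:
  "(\<And>w. w \<in> W i \<Longrightarrow> F' w \<in> W i) \<Longrightarrow> level i (F \<circ> F') = level i F \<circ> level i F'"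
  by (auto simp: level_def fun_eq_iff)

lemma level_prefix_act: "s permutes W l \<Longrightarrow> l \<le> i \<Longrightarrow> level i (prefix_act l s) = telescope_iota d l i s"
  by (auto simp: level_def telescope_iota_def prefix_act_def fun_eq_iff words_iff)

text \<open>Evenness is automatic, since \<open>g\<close> is mapped homomorphically to the permutation of \<open>X\<^sup>i\<close>.\<close>

lemma level_tail_act_in_Alt:
  assumes g: "g \<in> carrier (Alt pairs)"
  shows "level i (T g) \<in> carrier (Alt (W i))"
proof -
  have step: "T p w \<in> W i" if "p permutes pairs" "w \<in> W i" for p w
    using that set_tail_act[OF that(1), of w] by (simp add: words_iff length_tail_act)
  have comp: "level i (T (p \<circ> q)) = level i (T p) \<circ> level i (T q)" if "p permutes pairs" "q permutes pairs" for p q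
    using step[OF that(2)] by (simp add: tail_act_comp[OF that(2)] level_comp)
  have perm: "level i (T p) permutes W i" if p: "p permutes pairs" for p
  proof (rule bij_imp_permutes)
    have inverse: "T p (T (inv' p) w) = w" "T (inv' p) (T p w) = w" for w
      using fun_cong[OF tail_act_inv_comp(1)[OF p], of w] fun_cong[OF tail_act_inv_comp(2)[OF p], of w]
      by simp_all
    show "bij_betw (level i (T p)) (W i) (W i)"
      by (rule bij_betw_byWitness[where f' = "level i (T (inv' p))"])
        (use inverse p permutes_inv[OF p] step in \<open>auto simp: level_def\<close>)
  qed (simp add: level_def)
  show ?thesis
    using Alt_hom_even[OF finite_pairs finite_words, of "\<lambda>g. level i (T g)" i g] perm comp g AltD[OF g]
    by (simp add: carrier_Alt)
qed

lemma level_in_Alt: "F \<in> tower \<Longrightarrow> i \<ge> 1 \<Longrightarrow> level i F \<in> carrier (Alt (W i))"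
proof (induction F rule: tower.induct)
  case tower_id
  have "level i id = id" by (auto simp: level_def)
  then show ?case using Alt_closed(1) by (simp only:)
next
  case (tower_prefix F s)
  then have "level i (prefix_act 1 s) \<in> carrier (Alt (W i))"
    using iota_in_Alt[of s 1 i] level_prefix_act[OF AltD, of s 1 i] by simp
  then have "level i (prefix_act 1 s) \<circ> level i F \<in> carrier (Alt (W i))"
    using tower_prefix.IH[OF tower_prefix.prems] by (rule Alt_closed(4))
  moreover have "level i (prefix_act 1 s \<circ> F) = level i (prefix_act 1 s) \<circ> level i F"
    using tower_words[OF tower_prefix(1)] by (rule level_comp)
  ultimately show ?case by (simp only:)
next
  case (tower_tail F g)
  have "level i (T g \<circ> F) = level i (T g) \<circ> level i F"
    using tower_words[OF tower_tail(1)] by (rule level_comp)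
  moreover have "level i (T g) \<circ> level i F \<in> carrier (Alt (W i))"
    using level_tail_act_in_Alt[OF tower_tail(2)] tower_tail.IH[OF tower_tail.prems]
    by (rule Alt_closed(4))
  ultimately show ?case by (simp only:)
qed

lemma group_Omega: "group (telescope_Omega d i)"
  unfolding telescope_Omega_def by (rule group_Alt[OF finite_words])

lemma group_P: "group P"
  unfolding telescope_P_def by (rule product_group) (rule group_Omega)

lemma carrier_P: "carrier P = (\<Pi>\<^sub>E i\<in>{1..}. carrier (Alt (W i)))"
  by (simp add: telescope_P_def telescope_Omega_def)

lemma one_P: "\<one>\<^bsub>P\<^esub> = (\<lambda>i\<in>{1..}. id)"
  by (simp add: telescope_P_def telescope_Omega_def Alt_def)

lemma mult_P: "x \<otimes>\<^bsub>P\<^esub> y = (\<lambda>i\<in>{1..}. x i \<circ> y i)"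
  by (simp add: telescope_P_def telescope_Omega_def Alt_def)

lemma levels_comp: "F' \<in> tower \<Longrightarrow> levels (F \<circ> F') = levels F \<otimes>\<^bsub>P\<^esub> levels F'"
  unfolding levels_def mult_P by (rule ext) (simp add: level_comp tower_words)

lemma group_tower: "group tower_monoid"
proof (rule groupI)
  fix F assume "F \<in> carrier tower_monoid"
  then have F: "F \<in> tower" by (simp add: tower_monoid_def)
  have "inv' F \<circ> F = id" using tower_closed(2)[OF F] by (simp add: bij_is_inj)
  then show "\<exists>F'\<in>carrier tower_monoid. F' \<otimes>\<^bsub>tower_monoid\<^esub> F = \<one>\<^bsub>tower_monoid\<^esub>"
    using tower_closed(3)[OF F] by (auto simp: tower_monoid_def)
qed (auto simp: tower_monoid_def tower_closed comp_assoc)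

lemma inv_tower_monoid: "F \<in> tower \<Longrightarrow> inv\<^bsub>tower_monoid\<^esub> F = inv' F"
  by (rule group.inv_equality[OF group_tower])
    (simp_all add: tower_monoid_def tower_closed bij_is_inj)

lemma levels_hom: "group_hom tower_monoid P levels"
proof -
  have "levels F \<in> carrier P" if "F \<in> tower" for F
    using level_in_Alt[OF that] by (auto simp: carrier_P levels_def)
  then show ?thesis
    using group_tower group_P levels_comp
    by (auto simp: group_hom_def group_hom_axioms_def hom_def tower_monoid_def)
qed

lemma levels_prefix_act: "s \<in> carrier (Alt (W 1)) \<Longrightarrow> levels (prefix_act 1 s) = telescope_Delta1 d s"
  unfolding levels_def telescope_Delta1_def using level_prefix_act[OF AltD, of s 1] by auto

text \<open>The factors of the product act below \<open>d\<^bsup>k-2\<^esup>\<close> on the next two letters. At most one of them moves a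
  given word, namely the one for which these two letters come directly after the leading \<open>d\<close>s. The factors
  from \<open>m\<close> on amount to the tail action below \<open>d\<^bsup>m-2\<^esup>\<close>.\<close>

lemma foldr_tail_act:
  assumes g: "g permutes pairs" and w: "w \<in> W i" and "2 \<le> m" "m \<le> i + 1"
  shows "foldr (\<circ>) (map (\<lambda>k. telescope_iota d k i (telescope_phi d k g)) [m..<i + 1]) id w =
    (if take (m - 2) w = replicate (m - 2) d then replicate (m - 2) d @ T g (drop (m - 2) w) else w)"
  using assms(4,3)
proof (induction m rule: inc_induct)
  case base
  have lw: "length w = i" using w by (simp add: words_iff)
  have "length (drop (i - 1) w) \<le> 1" using lw by simp
  then have "T g (drop (i - 1) w) = drop (i - 1) w"
    by (cases "drop (i - 1) w" rule: list.exhaust; cases "tl (drop (i - 1) w)") auto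
  then show ?case using base by (auto simp: numeral_2_eq_2) (metis append_take_drop_id)
next
  case (step m)
  let ?R = "foldr (\<circ>) (map (\<lambda>k. telescope_iota d k i (telescope_phi d k g)) [Suc m..<i + 1]) id"
  have lw: "length w = i" "set w \<subseteq> {1..d}" using w by (auto simp: words_iff)
  have m: "m \<le> i" "2 \<le> m" "Suc m - 2 = Suc (m - 2)" using step by auto
  have unf: "foldr (\<circ>) (map (\<lambda>k. telescope_iota d k i (telescope_phi d k g)) [m..<i + 1]) id w =
    telescope_iota d m i (telescope_phi d m g) (?R w)"
  proof -
    have "[m..<i + 1] = m # [Suc m..<i + 1]" using m(1) by (intro upt_conv_Cons) simp
    then show ?thesis by (simp only: list.map foldr.simps comp_apply)
  qed
  define n where "n = m - 2"
  have mn: "m = n + 2" using m by (simp add: n_def)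
  define v where "v = ?R w"
  have "2 \<le> Suc m" using m by simp
  from step(3)[OF this]
  have IH: "v = (if take (Suc n) w = replicate (Suc n) d then replicate (Suc n) d @ T g (drop (Suc n) w) else w)"
    unfolding v_def m(3) n_def .
  note unf = unf[folded v_def]
  show ?case
  proof (cases "take n w = replicate n d")
    case False
    have "take (Suc n) w \<noteq> replicate (Suc n) d"
    proof
      assume "take (Suc n) w = replicate (Suc n) d"
      then have "take n (take (Suc n) w) = take n (replicate (Suc n) d)" by (rule arg_cong)
      then show False using False by (simp del: replicate_Suc)
    qed
    then have R: "v = w" using IH m by (simp add: mn)
    have "take n (take m w) \<noteq> replicate n d" using False by (simp add: mn)
    then have "telescope_phi d m g (take m w) = take m w" by (simp add: telescope_phi_def mn)
    then show ?thesis unfolding unf R using False w by (simp add: telescope_iota_def mn)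
  next
    case True
    then obtain x y z where wz: "w = replicate n d @ x # y # z"
    proof -
      have "w = replicate n d @ drop n w" using True by (metis append_take_drop_id)
      moreover have "2 \<le> length (drop n w)" using lw(1) m(1) mn by simp
      then obtain x y z where "drop n w = x # y # z"
        unfolding numeral_2_eq_2 Suc_le_length_iff by blast
      ultimately show ?thesis using that[of x y z] by simp
    qed
    have tk: "take m (replicate n d @ x' # y' # z') = replicate n d @ [x', y']" for x' y' z' by (simp add: mn)
    have phi: "telescope_phi d m g (replicate n d @ [x', y']) = replicate n d @ g [x', y']"
      if "{x', y'} \<subseteq> {1..d}" for x' y'
      using that d5 by (auto simp: telescope_phi_def mn words_iff)
    have dr: "drop m (replicate n d @ x' # y' # z') = z'" for x' y' z' by (simp add: mn)
    have io: "telescope_iota d m i (telescope_phi d m g) (replicate n d @ x' # y' # z') =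
        replicate n d @ g [x', y'] @ z'" if "replicate n d @ x' # y' # z' \<in> W i" for x' y' z'
    proof -
      have "{x', y'} \<subseteq> {1..d}" using that by (auto simp: words_iff)
      then show ?thesis using that
        by (simp only: telescope_iota_def tk dr phi if_True append.assoc)
    qed
    show ?thesis
    proof (cases "x = d")
      case True
      have "v = replicate (Suc n) d @ T g (y # z)"
        using IH m by (simp add: mn wz True replicate_append_same[symmetric])
      then obtain y' z' where R: "v = replicate n d @ d # y' # z'" "T g (y # z) = y' # z'"
        using length_tail_act[OF g, of "y # z"]
        by (cases "T g (y # z)") (auto simp: replicate_append_same[symmetric])
      have Rw: "v \<in> W i"
      proof -
        have "set (T g (y # z)) \<subseteq> {1..d}" using set_tail_act[OF g] lw(2) wz by simp
        then show ?thesis using R lw wz length_tail_act[OF g, of "y # z"] d5 by (auto simp: words_iff)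
      qed
      have "g [d, y'] = [d, y']" using perm_pairs_fixes_e[OF g] rd d5 by simp
      then have "telescope_iota d m i (telescope_phi d m g) v = v"
        using io[of d y' z'] Rw by (simp add: R(1))
      then show ?thesis unfolding unf using R by (simp add: mn wz True)
    next
      case False
      have R: "v = w" using IH m False by (simp add: mn wz replicate_append_same[symmetric])
      then show ?thesis unfolding unf R using w io[of x y z] False by (simp add: wz mn)
    qed
  qed
qed

lemma levels_tail_act:
  assumes "g \<in> carrier (Alt pairs)"
  shows "levels (T g) = telescope_tilde d g"
proof -
  note g = AltD[OF assms]
  have "level i (T g) = (if i = 1 then id
    else foldr (\<circ>) (map (\<lambda>k. telescope_iota d k i (telescope_phi d k g)) [2..<i + 1]) id)" if "i \<ge> 1" for i
  proof
    fix w
    have "foldr (\<circ>) (map (\<lambda>k. telescope_iota d k i (telescope_phi d k g)) ks) id w = w" if "w \<notin> W i" for ks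
      using that by (induction ks) (auto simp: telescope_iota_def)
    moreover have "T g w = w" if "w \<in> W 1"
      using that by (cases w; cases "tl w") (auto simp: words_iff)
    moreover have "foldr (\<circ>) (map (\<lambda>k. telescope_iota d k i (telescope_phi d k g)) [2..<i + 1]) id w = T g w"
      if "w \<in> W i" using foldr_tail_act[OF g that, of 2] \<open>i \<ge> 1\<close> by (simp del: upt_Suc)
    ultimately show "level i (T g) w = (if i = 1 then id
      else foldr (\<circ>) (map (\<lambda>k. telescope_iota d k i (telescope_phi d k g)) [2..<i + 1]) id) w"
      by (cases "w \<in> W i"; cases "i = 1") (simp_all add: level_def del: upt_Suc)
  qed
  then show ?thesis by (auto simp: levels_def telescope_tilde_def)
qed

lemma carrier_G: "carrier G = levels ` tower"
proof -
  interpret L: group_hom tower_monoid P levels by (rule levels_hom)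
  let ?gen = "telescope_Delta1 d ` carrier (telescope_Omega d 1) \<union> telescope_tilde d ` carrier (telescope_B d r)"
  have gen: "?gen = levels ` (prefix_act 1 ` carrier (Alt (W 1)) \<union> T ` carrier (Alt pairs))"
    unfolding carrier_Omega carrier_B image_Un image_image
    by (intro arg_cong2[of _ _ _ _ "(\<union>)"] image_cong) (simp_all add: levels_prefix_act[unfolded One_nat_def] levels_tail_act)
  have "carrier G = generate P ?gen" by (simp add: telescope_group_def)
  also have "\<dots> = levels ` tower"
  proof
    have "subgroup (levels ` tower) P" using L.img_is_subgroup by (simp add: tower_monoid_def)
    then show "generate P ?gen \<subseteq> levels ` tower"
      unfolding gen using prefix_act_in_tower tail_act_in_tower
      by (intro L.H.generate_subgroup_incl) auto
    show "levels ` tower \<subseteq> generate P ?gen"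
    proof
      fix x assume "x \<in> levels ` tower"
      then obtain F where "F \<in> tower" "x = levels F" by blast
      then show "x \<in> generate P ?gen"
      proof (induction F arbitrary: x)
        case tower_id
        have "levels id = \<one>\<^bsub>P\<^esub>" using L.hom_one by (simp add: tower_monoid_def)
        then show ?case using tower_id generate.one by metis
      next
        case (tower_prefix F s)
        have "levels (prefix_act 1 s) \<in> generate P ?gen"
          unfolding gen using tower_prefix(2) by (intro generate.incl) blast
        then show ?case using tower_prefix generate.eng levels_comp by metis
      next
        case (tower_tail F g)
        have "levels (T g) \<in> generate P ?gen"
          unfolding gen using tower_tail(2) by (intro generate.incl) blast
        then show ?case using tower_tail generate.eng levels_comp by metis
      qed
    qed
  qed
  finally show ?thesis .
qed

lemma group_G: "group G"
proof -
  interpret L: group_hom tower_monoid P levels by (rule levels_hom)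
  have "subgroup (carrier G) P" unfolding carrier_G using L.img_is_subgroup by (simp add: tower_monoid_def)
  then have "group (P\<lparr>carrier := carrier G\<rparr>)" by (rule L.H.subgroup_imp_group)
  moreover have "P\<lparr>carrier := carrier G\<rparr> = G" by (simp add: telescope_group_def)
  ultimately show ?thesis by simp
qed

lemma levels_hom_G: "group_hom tower_monoid G levels"
proof -
  have "monoid.mult G = monoid.mult P" by (simp add: telescope_group_def)
  then show ?thesis
    using group_tower group_G levels_comp
    by (auto simp: group_hom_def group_hom_axioms_def hom_def carrier_G tower_monoid_def)
qed

lemma S_iff: "x \<in> S \<longleftrightarrow> x \<in> carrier P \<and> finite {i \<in> {1..}. x i \<noteq> id}"
  by (simp add: carrier_sum_group group_Omega carrier_P carrier_Omega)
    (simp add: telescope_Omega_def Alt_def)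

text \<open>The prefix action of \<open>s\<close> is \<open>s\<close> in the factor \<open>a\<close> and trivial in smaller ones. In the larger
  factors it agrees with a prefix action of length \<open>a + 1\<close>, which is trivial in the factor \<open>a\<close>. The
  quotient is concentrated in one factor, and such elements generate the direct sum.\<close>

lemma levels_concentrated:
  assumes "a \<ge> 1" and s: "s \<in> carrier (Alt (W a))"
  obtains F where "F \<in> tower" "levels F = (\<lambda>i\<in>{1..}. if i = a then s else id)"
proof -
  let ?s = "telescope_iota d a (a + 1) s"
  let ?A = "prefix_act a s" and ?B = "prefix_act (a + 1) ?s"
  have sA: "?s \<in> carrier (Alt (W (a + 1)))" by (rule iota_in_Alt[OF s]) simp
  have At: "?A \<in> tower" using tower_prefix_act[of s "a - 1"] s assms(1) by simp
  have Bt: "?B \<in> tower" using tower_prefix_act[OF sA] .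
  have bB: "bij ?B" using tower_closed(2)[OF Bt] .
  have short: "inv' ?B w = w" if "length w \<le> a" for w
    unfolding inv_prefix_act[OF AltD[OF sA]] using that by (simp add: prefix_act_def)
  have "level i (inv' ?B \<circ> ?A) = (if i = a then s else id)" if "i \<ge> 1" for i
  proof
    fix w
    have len: "length (?A w) = length w" by (rule length_prefix_act[OF AltD[OF s]])
    show "level i (inv' ?B \<circ> ?A) w = (if i = a then s else id) w"
    proof (cases "w \<in> W i")
      case w: True
      then have lw: "length w = i" "set w \<subseteq> {1..d}" by (auto simp: words_iff)
      consider "i < a" | "i = a" | "i > a" by linarith
      then show ?thesis
      proof cases
        case 1
        then show ?thesis using w lw short[of w] by (simp add: level_def prefix_act_def[of a])
      next
        case 2
        then show ?thesis using w lw short[of "s w"] len by (simp add: level_def prefix_act_def[of a])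
      next
        case 3
        have "?B w = ?A w" using prefix_act_iota[OF AltD[OF s], of "a + 1" w] lw 3 by simp
        then have "inv' ?B (?A w) = w" using bB by (metis inv_bij_simps(1))
        then show ?thesis using w 3 by (simp add: level_def)
      qed
    next
      case False
      then show ?thesis using permutes_not_in[OF AltD[OF s]] by (auto simp: level_def)
    qed
  qed
  then have "levels (inv' ?B \<circ> ?A) = (\<lambda>i\<in>{1..}. if i = a then s else id)"
    by (auto simp: levels_def)
  then show ?thesis using that tower_closed(4)[OF tower_closed(3)[OF Bt] At] by blast
qed

lemma finite_support_in_image:
  assumes "finite A" "x \<in> carrier P" "\<And>i. i \<ge> 1 \<Longrightarrow> i \<notin> A \<Longrightarrow> x i = id"
  shows "x \<in> levels ` tower"
  using assms
proof (induction A arbitrary: x)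
  case empty
  interpret L: group_hom tower_monoid P levels by (rule levels_hom)
  have "x = \<one>\<^bsub>P\<^esub>"
    using empty(1,2) by (intro ext) (auto simp: one_P carrier_P PiE_def extensional_def)
  also have "\<dots> = levels id" using L.hom_one by (simp add: tower_monoid_def)
  finally show ?case using tower_id by blast
next
  case (insert a A)
  show ?case
  proof (cases "a \<ge> 1")
    case False
    then show ?thesis using insert by (metis insertE)
  next
    case True
    let ?y = "x(a := id)"
    have xa: "x a \<in> carrier (Alt (W a))" using insert.prems(1) True by (auto simp: carrier_P)
    have y: "?y \<in> carrier P"
      using insert.prems(1) True Alt_closed(1)
      by (auto simp: carrier_P PiE_iff extensional_def)
    have "?y \<in> levels ` tower"
      by (rule insert.IH[OF y]) (use insert.prems in auto)
    then obtain F' where F': "F' \<in> tower" "levels F' = ?y" by (metis imageE)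
    obtain F where F: "F \<in> tower" "levels F = (\<lambda>i\<in>{1..}. if i = a then x a else id)"
      using levels_concentrated[OF True xa] by blast
    have "levels (F \<circ> F') = x"
      unfolding levels_comp[OF F'(1)] F(2) F'(2) mult_P using insert.prems(1) True
      by (intro ext) (auto simp: carrier_P PiE_def extensional_def)
    then show ?thesis using tower_closed(4)[OF F(1) F'(1)] by blast
  qed
qed

lemma fin_eq_id_iff:
  assumes "F \<in> tower" shows "fin_eq F id \<longleftrightarrow> levels F \<in> S"
proof -
  have "levels F \<in> carrier P" using group_hom.hom_closed[OF levels_hom, of F] assms by (simp add: tower_monoid_def)
  then have S: "levels F \<in> S \<longleftrightarrow> finite {i \<in> {1..}. level i F \<noteq> id}"
    unfolding S_iff by (simp add: levels_def cong: conj_cong)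
  have lev: "level i F = id \<longleftrightarrow> (\<forall>w\<in>W i. F w = w)" for i
    by (auto simp: level_def fun_eq_iff)
  show ?thesis
  proof
    assume "fin_eq F id"
    then obtain L where L: "\<And>w. set w \<subseteq> {1..d} \<Longrightarrow> L \<le> length w \<Longrightarrow> F w = w" by (auto simp: fin_eq_def)
    then have "{i \<in> {1..}. level i F \<noteq> id} \<subseteq> {..<L}"
      by (auto simp: lev words_iff) (meson not_le)
    then show "levels F \<in> S" unfolding S by (rule finite_subset) simp
  next
    assume "levels F \<in> S"
    then obtain L where L: "{i \<in> {1..}. level i F \<noteq> id} \<subseteq> {..<L}"
      unfolding S finite_nat_iff_bounded by blast
    have "F w = w" if "set w \<subseteq> {1..d}" "Suc L \<le> length w" for w
    proof -
      have "level (length w) F = id"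
      proof (rule ccontr)
        assume "level (length w) F \<noteq> id"
        then have "length w \<in> {..<L}" using that(2) by (intro subsetD[OF L] CollectI conjI) auto
        then show False using that(2) by simp
      qed
      then show ?thesis using that by (simp add: lev words_iff)
    qed
    then show "fin_eq F id" by (auto simp: fin_eq_def)
  qed
qed

lemma S_eq: "S = levels ` {F \<in> tower. fin_eq F id}"
proof -
  have "x \<in> levels ` tower" if "x \<in> S" for x
    using that unfolding S_iff
    by (intro finite_support_in_image[of "{i \<in> {1..}. x i \<noteq> id}"]) auto
  then show ?thesis using fin_eq_id_iff by blast
qed

lemma fin_eq_comp:
  assumes "F \<in> tower" "F' \<in> tower"
  shows "fin_eq F F' \<longleftrightarrow> fin_eq (inv' F' \<circ> F) id"
proof -
  have "F w = F' w \<longleftrightarrow> inv' F' (F w) = w" for w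
    using tower_closed(2)[OF assms(2)] by (metis inv_bij_simps)
  then show ?thesis by (simp add: fin_eq_def)
qed

text \<open>The elements of the tower that fix all long words form a normal subgroup, and the direct
  sum is its image under a surjective homomorphism.\<close>

lemma normal_S: "S \<lhd> G"
proof -
  interpret L: group_hom tower_monoid G levels by (rule levels_hom_G)
  have "{F \<in> tower. fin_eq F id} \<lhd> tower_monoid"
    unfolding L.G.normal_inv_iff
  proof (intro conjI ballI)
    note cl = tower_closed
    have comp: "fin_eq (F \<circ> H \<circ> F') id" if "F \<in> tower" "F' \<in> tower" and H: "fin_eq H id" and "F \<circ> F' = id" for F H F'
    proof -
      obtain L where L: "\<And>w. set w \<subseteq> {1..d} \<Longrightarrow> L \<le> length w \<Longrightarrow> H w = w"
        using H by (auto simp: fin_eq_def)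
      have "(F \<circ> H \<circ> F') w = w" if w: "set w \<subseteq> {1..d}" "L \<le> length w" for w
      proof -
        have "set (F' w) \<subseteq> {1..d}" using tower_words[OF \<open>F' \<in> tower\<close>, of w "length w"] w by (simp add: words_iff)
        then show ?thesis
          using L[of "F' w"] length_tower[OF \<open>F' \<in> tower\<close>, of w] w fun_cong[OF \<open>F \<circ> F' = id\<close>, of w] by simp
      qed
      then show ?thesis by (auto simp: fin_eq_def)
    qed
    show "subgroup {F \<in> tower. fin_eq F id} tower_monoid"
    proof (rule L.G.subgroupI)
      show "{F \<in> tower. fin_eq F id} \<subseteq> carrier tower_monoid" by (auto simp: tower_monoid_def)
      show "{F \<in> tower. fin_eq F id} \<noteq> {}" using cl(1) by (auto simp: fin_eq_def)
      fix F assume F: "F \<in> {F \<in> tower. fin_eq F id}"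
      then have "fin_eq id F" using fin_eq_sym by blast
      then have "fin_eq (inv' F) id" using fin_eq_comp[of id F] F cl(1) by simp
      then show "inv\<^bsub>tower_monoid\<^esub> F \<in> {F \<in> tower. fin_eq F id}"
        using F cl(3) by (simp add: inv_tower_monoid)
      fix F' assume F': "F' \<in> {F \<in> tower. fin_eq F id}"
      obtain L L' where "\<And>w. set w \<subseteq> {1..d} \<Longrightarrow> L \<le> length w \<Longrightarrow> F w = w"
        "\<And>w. set w \<subseteq> {1..d} \<Longrightarrow> L' \<le> length w \<Longrightarrow> F' w = w"
        using F F' by (auto simp: fin_eq_def)
      then have "(F \<circ> F') w = id w" if "set w \<subseteq> {1..d}" "max L L' \<le> length w" for w
        using that by simp
      then have "fin_eq (F \<circ> F') id" unfolding fin_eq_def by blast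
      then show "F \<otimes>\<^bsub>tower_monoid\<^esub> F' \<in> {F \<in> tower. fin_eq F id}"
        using F F' cl(4) by (simp add: tower_monoid_def)
    qed
    fix F H assume F: "F \<in> carrier tower_monoid" and H: "H \<in> {F \<in> tower. fin_eq F id}"
    have Ft: "F \<in> tower" using F by (simp add: tower_monoid_def)
    have "F \<circ> inv' F = id" using cl(2)[OF Ft] by (simp add: fun_eq_iff)
    then have "fin_eq (F \<circ> H \<circ> inv' F) id" using comp[OF Ft cl(3)[OF Ft]] H by blast
    moreover have "F \<circ> H \<circ> inv' F \<in> tower" using cl(3,4) Ft H by blast
    ultimately show "F \<otimes>\<^bsub>tower_monoid\<^esub> H \<otimes>\<^bsub>tower_monoid\<^esub> inv\<^bsub>tower_monoid\<^esub> F \<in> {F \<in> tower. fin_eq F id}"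
      using Ft by (simp only: inv_tower_monoid) (simp add: tower_monoid_def)
  qed
  then have "levels ` {F \<in> tower. fin_eq F id} \<lhd> G"
    using levels_hom_G by (rule normal.surj_hom_normal_subgroup) (simp add: carrier_G tower_monoid_def)
  then show ?thesis by (simp only: S_eq)
qed

abbreviation "Q \<equiv> telescope_head d r"

definition head_map :: "(nat list \<Rightarrow> nat list) \<Rightarrow> (nat \<Rightarrow> nat list \<Rightarrow> nat list) set"
  where "head_map F = S #>\<^bsub>G\<^esub> levels F"

lemma head_map_hom: "group_hom tower_monoid Q head_map"
proof -
  interpret N: normal S G by (rule normal_S)
  interpret L: group_hom tower_monoid G levels by (rule levels_hom_G)
  have "(\<lambda>x. S #>\<^bsub>G\<^esub> x) \<circ> levels \<in> hom tower_monoid (G Mod S)"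
    using N.r_coset_hom_Mod L.homh by (rule Group.hom_compose[rotated])
  moreover have "(\<lambda>x. S #>\<^bsub>G\<^esub> x) \<circ> levels = head_map" by (auto simp: head_map_def)
  ultimately show ?thesis
    using N.factorgroup_is_group group_tower
    by (simp add: group_hom_def group_hom_axioms_def telescope_head_def)
qed

lemma carrier_Q: "carrier Q = head_map ` tower"
  by (auto simp: telescope_head_def carrier_FactGroup carrier_G head_map_def)

lemma head_map_eq_one: "F \<in> tower \<Longrightarrow> head_map F = \<one>\<^bsub>Q\<^esub> \<longleftrightarrow> fin_eq F id"
proof -
  assume F: "F \<in> tower"
  interpret N: normal S G by (rule normal_S)
  have "levels F \<in> carrier G" using F by (simp add: carrier_G)
  then have "S #>\<^bsub>G\<^esub> levels F = S \<longleftrightarrow> levels F \<in> S"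
    using N.coset_join1 N.rcos_const[OF N.is_group] N.subgroup_axioms N.subset by metis
  then show ?thesis using fin_eq_id_iff[OF F] by (simp add: head_map_def telescope_head_def)
qed

lemma head_map_eq_iff:
  assumes "F \<in> tower" "F' \<in> tower" shows "head_map F = head_map F' \<longleftrightarrow> fin_eq F F'"
proof -
  interpret H: group_hom tower_monoid Q head_map by (rule head_map_hom)
  have c: "F \<in> carrier tower_monoid" "F' \<in> carrier tower_monoid" using assms by (simp_all add: tower_monoid_def)
  have "fin_eq F F' \<longleftrightarrow> head_map (inv' F' \<circ> F) = \<one>\<^bsub>Q\<^esub>"
    using fin_eq_comp[OF assms] head_map_eq_one tower_closed(3,4) assms by simp
  also have "inv' F' \<circ> F = inv\<^bsub>tower_monoid\<^esub> F' \<otimes>\<^bsub>tower_monoid\<^esub> F"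
    by (simp only: inv_tower_monoid[OF assms(2)]) (simp add: tower_monoid_def)
  also have "head_map \<dots> = inv\<^bsub>Q\<^esub> head_map F' \<otimes>\<^bsub>Q\<^esub> head_map F" using c by simp
  also have "\<dots> = \<one>\<^bsub>Q\<^esub> \<longleftrightarrow> head_map F = head_map F'"
    using H.hom_closed[OF c(1)] H.hom_closed[OF c(2)]
    by (metis H.H.inv_closed H.H.inv_equality H.H.inv_inv H.H.l_inv)
  finally show ?thesis by simp
qed

text \<open>Subgroups of the head are studied through their preimages in the tower.\<close>

lemma perm_group_of_subgroup:
  assumes "subgroup H Q"
  shows "perm_group {F \<in> tower. head_map F \<in> H}" "saturated {F \<in> tower. head_map F \<in> H}"
proof -
  interpret L: group_hom tower_monoid Q head_map by (rule head_map_hom)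
  interpret S: subgroup H Q by (rule assms)
  have one: "head_map id = \<one>\<^bsub>Q\<^esub>" using L.hom_one by (simp add: tower_monoid_def)
  have mult: "head_map (F \<circ> F') = head_map F \<otimes>\<^bsub>Q\<^esub> head_map F'" if "F \<in> tower" "F' \<in> tower" for F F'
    using L.hom_mult that by (simp add: tower_monoid_def)
  have inv: "head_map (inv' F) = inv\<^bsub>Q\<^esub> head_map F" if "F \<in> tower" for F
    using L.hom_inv[of F] that by (simp add: inv_tower_monoid) (simp add: tower_monoid_def)
  show "perm_group {F \<in> tower. head_map F \<in> H}"
    using tower_closed one mult inv by (simp add: perm_group_def)
  show "saturated {F \<in> tower. head_map F \<in> H}"
    by (clarsimp simp: saturated_def) (metis head_map_eq_iff)
qed

theorem head_two_generated: "is_two_generated Q"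
proof -
  interpret L: group_hom tower_monoid Q head_map by (rule head_map_hom)
  obtain x y where xy: "x \<in> tower" "y \<in> tower"
    "\<And>M. perm_group M \<Longrightarrow> saturated M \<Longrightarrow> x \<in> M \<Longrightarrow> y \<in> M \<Longrightarrow> tower \<subseteq> M"
    using tower_two_generators by blast
  let ?K = "generate Q {head_map x, head_map y}"
  have c: "{head_map x, head_map y} \<subseteq> carrier Q" using xy by (auto simp: carrier_Q)
  have K: "subgroup ?K Q" using L.H.generate_is_subgroup[OF c] .
  have "tower \<subseteq> {F \<in> tower. head_map F \<in> ?K}"
    by (rule xy(3)[OF perm_group_of_subgroup[OF K]]) (use xy in \<open>auto intro: generate.incl\<close>)
  then have "carrier Q \<subseteq> ?K" by (auto simp: carrier_Q)
  then have "?K = carrier Q" using subgroup.subset[OF K] by blast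
  then show ?thesis using c unfolding is_two_generated_def by blast
qed

theorem head_infinite: "infinite (carrier Q)"
proof -
  have "inj (\<lambda>i. head_map (probe i))"
    using head_map_eq_iff[OF probe_in_tower probe_in_tower] probe_fin_eq_iff by (auto intro: injI)
  then have "infinite (range (\<lambda>i. head_map (probe i)))" by (simp add: finite_image_iff)
  moreover have "range (\<lambda>i. head_map (probe i)) \<subseteq> carrier Q" using probe_in_tower by (auto simp: carrier_Q)
  ultimately show ?thesis by (metis finite_subset)
qed

theorem head_simple: "is_simple_group Q"
  unfolding is_simple_group_def
proof (intro conjI allI impI)
  interpret L: group_hom tower_monoid Q head_map by (rule head_map_hom)
  show "group Q" by (rule L.H.is_group)
  show "carrier Q \<noteq> {\<one>\<^bsub>Q\<^esub>}" using head_infinite by auto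
  fix H assume H: "H \<lhd> Q"
  interpret N: normal H Q by (rule H)
  let ?N = "{F \<in> tower. head_map F \<in> H}"
  note N = perm_group_of_subgroup[OF N.subgroup_axioms]
  show "H = carrier Q \<or> H = {\<one>\<^bsub>Q\<^esub>}"
  proof (cases "\<exists>n\<in>?N. \<not> fin_eq n id")
    case True
    then obtain n where n: "n \<in> ?N" "\<not> fin_eq n id" by blast
    have "conj_by F F' \<in> ?N" if F: "F \<in> tower" and F': "F' \<in> ?N" for F F'
    proof -
      have c: "F \<in> carrier tower_monoid" "F' \<in> carrier tower_monoid" using F F' by (simp_all add: tower_monoid_def)
      have "conj_by F F' = F \<otimes>\<^bsub>tower_monoid\<^esub> F' \<otimes>\<^bsub>tower_monoid\<^esub> inv\<^bsub>tower_monoid\<^esub> F"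
        by (simp only: inv_tower_monoid[OF F] conj_by_def) (simp add: tower_monoid_def)
      then have "head_map (conj_by F F') = head_map F \<otimes>\<^bsub>Q\<^esub> head_map F' \<otimes>\<^bsub>Q\<^esub> inv\<^bsub>Q\<^esub> head_map F"
        using c by simp
      also have "\<dots> \<in> H" using N.inv_op_closed2[of "head_map F" "head_map F'"] c F' by simp
      finally show ?thesis using tower_closed(5)[OF F] F' by simp
    qed
    then have "?N = tower" using normal_subgroup_of_tower[OF N(1) _ _ N(2) n] by blast
    then show ?thesis using N.subset by (auto simp: carrier_Q)
  next
    case False
    then have "h = \<one>\<^bsub>Q\<^esub>" if "h \<in> H" for h
      using that N.subset head_map_eq_one by (auto simp: carrier_Q)
    then show ?thesis using N.one_closed by blast
  qed
qed

end

theorem theorem7p1: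
  fixes d r :: nat
  assumes "d \<ge> 5" and "2 \<le> r" and "r \<le> d - 3"
  shows "is_two_generated (telescope_head d r) \<and>
         infinite (carrier (telescope_head d r)) \<and>
         is_simple_group (telescope_head d r)"
proof -
  interpret telescope d r using assms by unfold_locales
  show ?thesis using head_two_generated head_infinite head_simple by blast
qed

end
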